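(* Let $\Omega=\{(\alpha,s): 0<\alpha<1,\ s\le 1/\alpha\}\cup\{(\alpha,s):\alpha>1,\ s\ge1/\alpha\}$. For $(\alpha,s)\in\Omega$ the generalised entanglement entropy $$E_{(\alpha,s)}(\Psi)=\frac{1}{s(1-\alpha)}\left[e^{s(1-\alpha)E_\alpha(\Psi)}-1\right]$$ (with the value at $s=0$ understood as the limit $s\to0$) is an entanglement monotone, in the sense that for every bipartite pure state $\ket{\Psi}_{AB}$: (i) $E_{(\alpha,s)}(\Psi)=0$ if and only if $\ket{\Psi}_{AB}$ is separable (a product vector); (ii) for every SLOCC protocol $\ket{\Psi}_{AB}\to\{p_m,\ket{\Psi_m}_{AB}\}$, $\sum_mp_mE_{(\alpha,s)}(\Psi_m)\le E_{(\alpha,s)}(\Psi)$. Moreover, $\lim_{s\to0}E_{(\alpha,s)}(\Psi)=E_\alpha(\Psi)$, and for $s=1$ one has $E_{(\alpha,1)}(\Psi)=\frac{1}{1-\alpha}\left(\mathrm{Tr}[\rho_B^\alpha]-1\right)$, the Tsallis entropy of $\rho_B=\mathrm{Tr}_A\ket{\Psi}\bra{\Psi}$.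
   Context: All Hilbert spaces are finite-dimensional; $\log$ is the natural logarithm. For a unit vector $\ket{\Psi}_{AB}\in\mathcal H_A\otimes\mathcal H_B$ put $\rho_B=\mathrm{Tr}_A\ket{\Psi}\bra{\Psi}$. For $\alpha>0$, $\alpha\ne1$, the Rényi entanglement entropy (REE) is $E_\alpha(\Psi)=\frac{1}{1-\alpha}\log\mathrm{Tr}[\rho_B^\alpha]$. SLOCC protocol on pure states: a finite number of rounds; in each round one of the two parties (chosen depending on previous outcomes) applies a local measurement, i.e. a finite family of Kraus operators $\{K_j\}$ on its own system (possibly with a different finite-dimensional output space) with $\sum_jK_j^\dagger K_j=\mathbb 1$, which may depend on all previously obtained (classically communicated) outcomes. A sequence $m$ of outcomes corresponds to a product operator $A_m\otimes B_m$; it occurs with probability $p_m=\|(A_m\otimes B_m)\ket{\Psi}\|^2$, and (if $p_m>0$) the outcome state is $\ket{\Psi_m}=(A_m\otimes B_m)\ket{\Psi}/\sqrt{p_m}$. Thus $\sum_mp_m=1$, and one writes $\ket{\Psi}\to\{p_m,\ket{\Psi_m}\}$ (outcomes with $p_m=0$ are discarded). *)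

theory Defs
  imports Complex_Main "Jordan_Normal_Form.Schur_Decomposition"
begin

(* Finite-dimensional Hilbert spaces are the coordinate spaces carrier_vec d of complex vectors.
   H_A \<otimes> H_B with dimensions dA, dB is carrier_vec (dA * dB); the product basis vector
   |i>|k> has index i * dB + k. *)

definition tensor_vec :: "complex vec \<Rightarrow> complex vec \<Rightarrow> complex vec" where
  "tensor_vec a b = vec (dim_vec a * dim_vec b)
     (\<lambda>i. a $ (i div dim_vec b) * b $ (i mod dim_vec b))"

definition tensor_mat :: "complex mat \<Rightarrow> complex mat \<Rightarrow> complex mat" where
  "tensor_mat A B = mat (dim_row A * dim_row B) (dim_col A * dim_col B)
     (\<lambda>(i, j). A $$ (i div dim_row B, j div dim_col B) * B $$ (i mod dim_row B, j mod dim_col B))"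

definition norm_sq :: "complex vec \<Rightarrow> real" where
  "norm_sq v = Re (v \<bullet>c v)"

definition bipartite_state :: "nat \<Rightarrow> nat \<Rightarrow> complex vec \<Rightarrow> bool" where
  "bipartite_state dA dB \<Psi> \<longleftrightarrow> \<Psi> \<in> carrier_vec (dA * dB) \<and> norm_sq \<Psi> = 1"

definition separable_vec :: "nat \<Rightarrow> nat \<Rightarrow> complex vec \<Rightarrow> bool" where
  "separable_vec dA dB \<Psi> \<longleftrightarrow>
     (\<exists>a \<in> carrier_vec dA. \<exists>b \<in> carrier_vec dB. \<Psi> = tensor_vec a b)"

definition projector :: "complex vec \<Rightarrow> complex mat" where
  "projector \<Psi> = mat (dim_vec \<Psi>) (dim_vec \<Psi>) (\<lambda>(i, j). \<Psi> $ i * cnj (\<Psi> $ j))"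

definition ptrace_A :: "nat \<Rightarrow> nat \<Rightarrow> complex mat \<Rightarrow> complex mat" where
  "ptrace_A dA dB \<rho> = mat dB dB (\<lambda>(k, l). \<Sum>i<dA. \<rho> $$ (i * dB + k, i * dB + l))"

definition reduced_B :: "nat \<Rightarrow> nat \<Rightarrow> complex vec \<Rightarrow> complex mat" where
  "reduced_B dA dB \<Psi> = ptrace_A dA dB (projector \<Psi>)"

definition mat_trace :: "complex mat \<Rightarrow> complex" where
  "mat_trace A = (\<Sum>i<dim_row A. A $$ (i, i))"

(* Functional calculus for a positive semidefinite A: if A = U diag(d) U^* with U unitary
   and d nonnegative, then A^a = U diag(d^a) U^*.  The result does not depend on the chosen
   diagonalisation.  Zero eigenvalues contribute 0 because 0 powr a = 0. *)
definition mat_powr :: "complex mat \<Rightarrow> real \<Rightarrow> complex mat" where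
  "mat_powr A a = (let n = dim_row A in
     THE X. \<exists>U (d :: nat \<Rightarrow> real).
       U \<in> carrier_mat n n \<and> mat_adjoint U * U = 1\<^sub>m n \<and> (\<forall>i<n. 0 \<le> d i) \<and>
       A = U * mat_diag n (\<lambda>i. complex_of_real (d i)) * mat_adjoint U \<and>
       X = U * mat_diag n (\<lambda>i. complex_of_real (d i powr a)) * mat_adjoint U)"

definition renyi_EE :: "nat \<Rightarrow> nat \<Rightarrow> real \<Rightarrow> complex vec \<Rightarrow> real" where
  "renyi_EE dA dB \<alpha> \<Psi> =
     1 / (1 - \<alpha>) * ln (Re (mat_trace (mat_powr (reduced_B dA dB \<Psi>) \<alpha>)))"

definition gen_EE :: "nat \<Rightarrow> nat \<Rightarrow> real \<Rightarrow> real \<Rightarrow> complex vec \<Rightarrow> real" where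
  "gen_EE dA dB \<alpha> s \<Psi> =
     (let F = (\<lambda>t. 1 / (t * (1 - \<alpha>)) * (exp (t * (1 - \<alpha>) * renyi_EE dA dB \<alpha> \<Psi>) - 1))
      in if s = 0 then Lim (at 0) F else F s)"

definition Omega :: "(real \<times> real) set" where
  "Omega = {(\<alpha>, s). 0 < \<alpha> \<and> \<alpha> < 1 \<and> s \<le> 1 / \<alpha>} \<union> {(\<alpha>, s). \<alpha> > 1 \<and> s \<ge> 1 / \<alpha>}"

definition measurement :: "nat \<Rightarrow> complex mat list \<Rightarrow> bool" where
  "measurement d Ks \<longleftrightarrow> (\<forall>K \<in> set Ks. dim_col K = d) \<and>
     foldr (\<lambda>K S. mat_adjoint K * K + S) Ks (0\<^sub>m d d) = 1\<^sub>m d"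

(* slocc_protocol dA dB L: L lists the pairs (A_m, B_m), one for each sequence m of outcomes, of
   some finite protocol on input dimensions dA, dB.  The rules peel off the first round: Ks is its
   measurement, and Ls ! j lists the operators of the protocol that is carried on after outcome j
   (the two output dimensions are dim_row of the operators). *)
inductive slocc_protocol :: "nat \<Rightarrow> nat \<Rightarrow> (complex mat \<times> complex mat) list \<Rightarrow> bool" where
  stop: "slocc_protocol dA dB [(1\<^sub>m dA, 1\<^sub>m dB)]"
| round_A: "measurement dA Ks \<Longrightarrow> length Ls = length Ks \<Longrightarrow>
    (\<forall>j<length Ks. slocc_protocol (dim_row (Ks ! j)) dB (Ls ! j)) \<Longrightarrow>
    slocc_protocol dA dB (concat (map2 (\<lambda>K L. map (\<lambda>(A, B). (A * K, B)) L) Ks Ls))"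
| round_B: "measurement dB Ks \<Longrightarrow> length Ls = length Ks \<Longrightarrow>
    (\<forall>j<length Ks. slocc_protocol dA (dim_row (Ks ! j)) (Ls ! j)) \<Longrightarrow>
    slocc_protocol dA dB (concat (map2 (\<lambda>K L. map (\<lambda>(A, B). (A, B * K)) L) Ks Ls))"

definition outcome_prob :: "complex mat \<times> complex mat \<Rightarrow> complex vec \<Rightarrow> real" where
  "outcome_prob = (\<lambda>(A, B) \<Psi>. norm_sq (tensor_mat A B *\<^sub>v \<Psi>))"

definition outcome_state :: "complex mat \<times> complex mat \<Rightarrow> complex vec \<Rightarrow> complex vec" where
  "outcome_state = (\<lambda>(A, B) \<Psi>.
     complex_of_real (1 / sqrt (outcome_prob (A, B) \<Psi>)) \<cdot>\<^sub>v (tensor_mat A B *\<^sub>v \<Psi>))"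

end

theory Submission
  imports Defs "Jordan_Normal_Form.Spectral_Radius"
begin

text \<open>Write a vector of \<open>H_A \<otimes> H_B\<close> as its coefficient matrix \<open>X\<close>, so that \<open>\<rho>_B = X X^*\<close> and
  \<open>A \<otimes> B\<close> acts by \<open>X \<mapsto> B X A^T\<close>. With \<open>p = Tr \<rho>\<close> and \<open>N = (Tr \<rho>^\<alpha>)^(1/\<alpha>)\<close> the entropy, extended
  homogeneously to unnormalised vectors, is \<open>p g (N / p)\<close>, where \<open>g\<close> is concave on \<open>Omega\<close>, increasing for
  \<open>\<alpha> < 1\<close> and decreasing for \<open>\<alpha> > 1\<close>. It therefore suffices that in one round \<open>\<Sum>j. N j \<le> N\<close> for
  \<open>\<alpha> < 1\<close> and \<open>\<ge>\<close> for \<open>\<alpha> > 1\<close>. This is a Minkowski-type inequality which follows by Jensen once the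
  eigenvalues are related by \<open>d i = \<Sum>j k. P i j k * lam j k\<close> with nonnegative weights such that
  \<open>\<Sum>k. P i j k \<le> 1\<close> and \<open>\<Sum>i. P i j k = 1\<close>. If A measures, \<open>\<rho>\<close> is the sum of the outcome operators and
  the weights are squared moduli of the entries of a unitary matrix; if B measures, the outcome
  operators are \<open>K \<rho> K^*\<close>, and Bessel's inequality provides the weights.\<close>

section \<open>Entropies of nonnegative families\<close>

text \<open>Origin of \<Omega>: on a unit vector exp (s (1 - \<alpha>) E_\<alpha>) equals N to the
  power s \<alpha>, so g (x) is \<alpha> / (1 - \<alpha>) times (x^(s \<alpha>) - 1) / (s \<alpha>).
  The second factor is concave for s \<alpha> \<le> 1 and convex for s \<alpha> \<ge> 1, while the
  first is negative for \<alpha> > 1; concavity of g is therefore exactly membership in \<Omega>. N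
  is preferred to Tr \<rho>^\<alpha> because it has degree one in \<rho>. Hence p_m E(\<Psi>_m) is
  the extended entropy of the unnormalised outcome vector, conditional states never have to be
  normalised, and a protocol is treated round by round. The obstacle is a measurement of B: its
  outcome operators do not sum to \<rho> and may act on spaces of other dimensions. The usual way
  out is that both reduced operators have the same nonzero spectrum. Here the spectra on the side of
  B are compared directly, which is why the weights are required to be substochastic in the rows
  only.\<close>

definition dpow :: "real \<Rightarrow> real \<Rightarrow> real" where
  "dpow \<beta> x = (if \<beta> = 0 then ln x else (x powr \<beta> - 1) / \<beta>)"

text \<open>Both branches of \<open>dpow \<beta>\<close> vanish at 1 and have this derivative: it is
  the integral of t powr (\<beta> - 1) from 1 to x. Subtracting 1 in the power branch makes the
  logarithm the case \<beta> = 0, so that s = 0 needs no separate inequality.\<close>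

lemma has_real_derivative_dpow:
  assumes "x > 0"
  shows "(dpow \<beta> has_real_derivative x powr (\<beta> - 1)) (at x)"
proof (cases "\<beta> = 0")
  case True
  have "(ln has_real_derivative x powr (\<beta> - 1)) (at x)"
    using assms True DERIV_ln[of x] by (simp add: powr_minus)
  moreover have "dpow \<beta> = ln" using True by (simp add: dpow_def fun_eq_iff)
  ultimately show ?thesis by simp
next
  case False
  have "((\<lambda>x. (x powr \<beta> - 1) / \<beta>) has_real_derivative x powr (\<beta> - 1)) (at x)"
    using assms False by (auto intro!: derivative_eq_intros)
  moreover have "dpow \<beta> = (\<lambda>x. (x powr \<beta> - 1) / \<beta>)"
    using False by (simp add: dpow_def fun_eq_iff)
  ultimately show ?thesis by simp
qed

lemma dpow_one [simp]: "dpow \<beta> 1 = 0"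
  by (simp add: dpow_def)

text \<open>By the mean value theorem \<open>dpow \<beta> x\<close> is x - 1 times z powr (\<beta> -
  1) with z on the same side of 1 as x. Crossing from x > 1 to x < 1 reverses both the comparison of
  that factor with 1 and the sign of x - 1, so the inequality keeps its direction. For \<beta> = 0
  it reads ln x \<le> x - 1.\<close>

lemma dpow_bernoulli:
  assumes x: "x > 0"
  shows "\<beta> \<le> 1 \<Longrightarrow> dpow \<beta> x \<le> x - 1" and "\<beta> \<ge> 1 \<Longrightarrow> dpow \<beta> x \<ge> x - 1"
proof -
  have "\<exists>z>0. (z - 1) * (x - 1) \<ge> 0 \<and> dpow \<beta> x = (x - 1) * z powr (\<beta> - 1)"
  proof (cases x "1 :: real" rule: linorder_cases)
    case less
    obtain z where "x < z" "z < 1" "dpow \<beta> 1 - dpow \<beta> x = (1 - x) * z powr (\<beta> - 1)"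
      using MVT2[OF less, of "dpow \<beta>" "\<lambda>y. y powr (\<beta> - 1)"] has_real_derivative_dpow x by force
    then show ?thesis using x less
      by (intro exI[of _ z]) (auto simp: zero_le_mult_iff left_diff_distrib)
  next
    case equal
    then show ?thesis by (intro exI[of _ 1]) auto
  next
    case greater
    obtain z where "1 < z" "z < x" "dpow \<beta> x - dpow \<beta> 1 = (x - 1) * z powr (\<beta> - 1)"
      using MVT2[OF greater, of "dpow \<beta>" "\<lambda>y. y powr (\<beta> - 1)"] has_real_derivative_dpow by force
    then show ?thesis by (intro exI[of _ z]) (auto simp: zero_le_mult_iff)
  qed
  then obtain z where z: "z > 0" "(z - 1) * (x - 1) \<ge> 0" "dpow \<beta> x = (x - 1) * z powr (\<beta> - 1)"
    by blast
  have 1: "z powr (\<beta> - 1) \<le> 1" if "z \<ge> 1" "\<beta> \<le> 1"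
    using that powr_mono[of "\<beta> - 1" 0 z] by simp
  have 2: "z powr (\<beta> - 1) \<ge> 1" if "z \<ge> 1" "\<beta> \<ge> 1"
    using that powr_mono[of 0 "\<beta> - 1" z] by simp
  have 3: "z powr (\<beta> - 1) \<ge> 1" if "z \<le> 1" "\<beta> \<le> 1"
    using that z powr_mono'[of "\<beta> - 1" 0 z] by simp
  have 4: "z powr (\<beta> - 1) \<le> 1" if "z \<le> 1" "\<beta> \<ge> 1"
    using that z powr_mono'[of 0 "\<beta> - 1" z] by simp
  have cases: "x = 1 \<or> x < 1 \<and> z \<le> 1 \<or> x > 1 \<and> z \<ge> 1"
    using z(2) by (auto simp: zero_le_mult_iff)
  show "dpow \<beta> x \<le> x - 1" if "\<beta> \<le> 1"
    using cases 1 3 that mult_left_mono[of "z powr (\<beta> - 1)" 1 "x - 1"]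
      mult_left_mono_neg[of 1 "z powr (\<beta> - 1)" "x - 1"]
    by (auto simp: z(3))
  show "dpow \<beta> x \<ge> x - 1" if "\<beta> \<ge> 1"
    using cases 2 4 that mult_left_mono[of 1 "z powr (\<beta> - 1)" "x - 1"]
      mult_left_mono_neg[of "z powr (\<beta> - 1)" 1 "x - 1"]
    by (auto simp: z(3))
qed

text \<open>Rescaling the argument moves the base point, so that the tangent at 1 yields the tangent
  at every y > 0.\<close>

lemma dpow_divide:
  assumes "x > 0" "y > 0"
  shows "dpow \<beta> x = dpow \<beta> y + y powr \<beta> * dpow \<beta> (x / y)"
  using assms by (auto simp: dpow_def ln_div powr_divide field_simps)

lemma dpow_tangent:
  assumes "x > 0" "y > 0"
  shows "\<beta> \<le> 1 \<Longrightarrow> dpow \<beta> x \<le> dpow \<beta> y + y powr (\<beta> - 1) * (x - y)"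
    and "\<beta> \<ge> 1 \<Longrightarrow> dpow \<beta> x \<ge> dpow \<beta> y + y powr (\<beta> - 1) * (x - y)"
proof -
  have *: "y powr (\<beta> - 1) * (x - y) = y powr \<beta> * (x / y - 1)"
    using assms by (simp add: powr_diff field_simps)
  show "dpow \<beta> x \<le> dpow \<beta> y + y powr (\<beta> - 1) * (x - y)" if "\<beta> \<le> 1"
    unfolding dpow_divide[OF assms, of \<beta>] * using that assms dpow_bernoulli(1)[of "x / y" \<beta>]
    by (simp add: mult_left_mono)
  show "dpow \<beta> x \<ge> dpow \<beta> y + y powr (\<beta> - 1) * (x - y)" if "\<beta> \<ge> 1"
    unfolding dpow_divide[OF assms, of \<beta>] * using that assms dpow_bernoulli(2)[of "x / y" \<beta>]
    by (simp add: mult_left_mono)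
qed

text \<open>The right side is 1 - \<alpha> times the tangent of x powr \<alpha> at y. Eigenvalues
  may vanish whereas \<open>dpow\<close> is controlled only at positive arguments; at x = 0 the
  claim reduces to (1 - \<alpha>)^2 \<ge> 0.\<close>

lemma powr_tangent:
  fixes \<alpha> x y :: real
  assumes "\<alpha> > 0" "y > 0" "x \<ge> 0"
  shows "(1 - \<alpha>) * x powr \<alpha> \<le> (1 - \<alpha>) * (y powr \<alpha> * (1 - \<alpha> + \<alpha> * (x / y)))"
proof (cases "x = 0")
  case True
  have "0 \<le> ((1 - \<alpha>) * (1 - \<alpha>)) * y powr \<alpha>" by simp
  with True assms show ?thesis by (simp add: mult_ac)
next
  case False
  have *: "x powr \<alpha> = y powr \<alpha> * (1 + \<alpha> * dpow \<alpha> (x / y))"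
    using assms False by (simp add: dpow_def powr_divide field_simps)
  have "(1 - \<alpha>) * (1 + \<alpha> * dpow \<alpha> (x / y)) \<le> (1 - \<alpha>) * (1 - \<alpha> + \<alpha> * (x / y))"
  proof (cases "\<alpha> \<le> 1")
    case True
    have "dpow \<alpha> (x / y) \<le> x / y - 1"
      using True assms False by (intro dpow_bernoulli) auto
    then have "\<alpha> * dpow \<alpha> (x / y) \<le> \<alpha> * (x / y - 1)"
      using assms by (intro mult_left_mono) auto
    then show ?thesis using True by (intro mult_left_mono) (auto simp: algebra_simps)
  next
    case *: False
    have "dpow \<alpha> (x / y) \<ge> x / y - 1"
      using * assms False by (intro dpow_bernoulli) auto
    then have "\<alpha> * dpow \<alpha> (x / y) \<ge> \<alpha> * (x / y - 1)"
      using assms by (intro mult_left_mono) auto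
    then show ?thesis using * by (intro mult_left_mono_neg) (auto simp: algebra_simps)
  qed
  from mult_left_mono[OF this, of "y powr \<alpha>"] show ?thesis unfolding * by (simp add: mult_ac)
qed

text \<open>Multiplying by \<open>1 - \<alpha>\<close> treats the concave (\<open>\<alpha> < 1\<close>) and convex (\<open>\<alpha> > 1\<close>)
  cases at once; the weights may be substochastic because \<open>0 powr \<alpha> = 0\<close>.\<close>

lemma powr_jensen:
  fixes \<alpha> :: real
  assumes "finite K" "\<alpha> > 0" "\<And>k. k \<in> K \<Longrightarrow> w k \<ge> 0" "\<And>k. k \<in> K \<Longrightarrow> x k \<ge> 0" "sum w K \<le> 1"
  shows "(1 - \<alpha>) * (\<Sum>k\<in>K. w k * x k powr \<alpha>) \<le> (1 - \<alpha>) * (\<Sum>k\<in>K. w k * x k) powr \<alpha>"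
proof -
  define m where "m = (\<Sum>k\<in>K. w k * x k)"
  have m0: "m \<ge> 0" unfolding m_def using assms by (intro sum_nonneg mult_nonneg_nonneg) auto
  show ?thesis
  proof (cases "m = 0")
    case True
    then have "w k * x k = 0" if "k \<in> K" for k
      using that assms sum_nonneg_eq_0_iff[of K "\<lambda>k. w k * x k"] unfolding m_def by auto
    then have "w k * x k powr \<alpha> = 0" if "k \<in> K" for k using that by fastforce
    then have "(\<Sum>k\<in>K. w k * x k powr \<alpha>) = 0" by (intro sum.neutral) blast
    with True show ?thesis unfolding m_def by simp
  next
    case False
    with m0 have m: "m > 0" by simp
    have "(1 - \<alpha>) * (\<Sum>k\<in>K. w k * x k powr \<alpha>) = (\<Sum>k\<in>K. w k * ((1 - \<alpha>) * x k powr \<alpha>))"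
      by (simp add: sum_distrib_left mult_ac)
    also have "\<dots> \<le> (\<Sum>k\<in>K. w k * ((1 - \<alpha>) * (m powr \<alpha> * (1 - \<alpha> + \<alpha> * (x k / m)))))"
      using assms m by (intro sum_mono mult_left_mono powr_tangent) auto
    also have "\<dots> = (\<Sum>k\<in>K. (1 - \<alpha>) * m powr \<alpha> * ((1 - \<alpha>) * w k + \<alpha> / m * (w k * x k)))"
      by (intro sum.cong refl) (simp add: field_simps)
    also have "\<dots> = (1 - \<alpha>) * m powr \<alpha> * ((1 - \<alpha>) * sum w K + \<alpha> / m * m)"
      unfolding m_def sum_distrib_left sum.distrib[symmetric] ..
    \<comment> \<open>The missing mass \<open>1 - sum w K\<close> enters with the factor (1 -
      \<alpha>)^2, so its sign is favourable in both ranges of \<alpha>.\<close>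
    also have "\<dots> = (1 - \<alpha>) * m powr \<alpha> - (1 - \<alpha>)\<^sup>2 * (1 - sum w K) * m powr \<alpha>"
      using m by (simp add: field_simps power2_eq_square)
    also have "\<dots> \<le> (1 - \<alpha>) * m powr \<alpha>" using assms by simp
    finally show ?thesis unfolding m_def .
  qed
qed

section \<open>The functional N and the homogeneous entropy built on it\<close>

definition lp_norm :: "real \<Rightarrow> 'i set \<Rightarrow> ('i \<Rightarrow> real) \<Rightarrow> real" where
  "lp_norm \<alpha> I d = (\<Sum>i\<in>I. d i powr \<alpha>) powr (1 / \<alpha>)"

lemma lp_norm_nonneg: "lp_norm \<alpha> I d \<ge> 0"
  by (simp add: lp_norm_def)

lemma lp_norm_powr:
  "\<alpha> > 0 \<Longrightarrow> lp_norm \<alpha> I d powr \<alpha> = (\<Sum>i\<in>I. d i powr \<alpha>)"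
  by (simp add: lp_norm_def powr_powr sum_nonneg)

lemma lp_norm_eq_0_iff:
  assumes "finite I" "\<And>i. i \<in> I \<Longrightarrow> d i \<ge> 0" "\<alpha> > 0"
  shows "lp_norm \<alpha> I d = 0 \<longleftrightarrow> (\<forall>i\<in>I. d i = 0)"
  using assms by (auto simp: lp_norm_def sum_nonneg_eq_0_iff)

text \<open>With S the sum of the norms N j, each \<open>d i / S\<close> is a substochastic average
  of the rescaled values \<open>lam j k / N j\<close>, block j carrying mass at most N j / S. Jensen
  for each i, summed over i, leaves only column sums of the weights, which are 1, and the power sum
  of each nonzero rescaled block is 1 as well. The column condition is restricted to positive
  \<open>lam j k\<close> because the weights for measurements of B are quotients by
  \<open>lam j k\<close>.\<close>

lemma lp_norm_superadditive:
  fixes lam :: "'j \<Rightarrow> 'k \<Rightarrow> real" and P :: "'i \<Rightarrow> 'j \<Rightarrow> 'k \<Rightarrow> real"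
  assumes fin: "finite I" "finite J" "\<And>j. j \<in> J \<Longrightarrow> finite (K j)" and \<alpha>: "\<alpha> > 0"
    and lam: "\<And>j k. j \<in> J \<Longrightarrow> k \<in> K j \<Longrightarrow> lam j k \<ge> 0"
    and P: "\<And>i j k. i \<in> I \<Longrightarrow> j \<in> J \<Longrightarrow> k \<in> K j \<Longrightarrow> P i j k \<ge> 0"
    and row: "\<And>i j. i \<in> I \<Longrightarrow> j \<in> J \<Longrightarrow> (\<Sum>k\<in>K j. P i j k) \<le> 1"
    and column: "\<And>j k. j \<in> J \<Longrightarrow> k \<in> K j \<Longrightarrow> lam j k > 0 \<Longrightarrow> (\<Sum>i\<in>I. P i j k) = 1"
    and d: "\<And>i. i \<in> I \<Longrightarrow> d i = (\<Sum>j\<in>J. \<Sum>k\<in>K j. P i j k * lam j k)"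
  shows "(1 - \<alpha>) * (\<Sum>j\<in>J. lp_norm \<alpha> (K j) (lam j)) \<le> (1 - \<alpha>) * lp_norm \<alpha> I d"
proof -
  define N where "N j = lp_norm \<alpha> (K j) (lam j)" for j
  define S where "S = (\<Sum>j\<in>J. N j)"
  have N0: "N j \<ge> 0" for j by (simp add: N_def lp_norm_nonneg)
  have S0: "S \<ge> 0" unfolding S_def by (intro sum_nonneg N0)
  have lam0: "lam j k = 0" if "j \<in> J" "k \<in> K j" "N j = 0" for j k
    using that lam fin \<alpha> lp_norm_eq_0_iff[of "K j" "lam j" \<alpha>] by (auto simp: N_def)
  have d0: "d i \<ge> 0" if "i \<in> I" for i
    unfolding d[OF that] using that lam P by (intro sum_nonneg) auto
  show ?thesis
  proof (cases "S = 0")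
    case True
    then have "N j = 0" if "j \<in> J" for j
      using that fin N0 by (auto simp: S_def sum_nonneg_eq_0_iff)
    then have "d i = 0" if "i \<in> I" for i
      unfolding d[OF that] using lam0 by (intro sum.neutral ballI) auto
    then have "lp_norm \<alpha> I d = 0" by (simp add: lp_norm_def)
    with True show ?thesis by (simp add: S_def N_def)
  next
    case False
    with S0 have S: "S > 0" by simp
    define w where "w i jk = (case jk of (j, k) \<Rightarrow> N j / S * P i j k)" for i jk
    define x where "x jk = (case jk of (j, k) \<Rightarrow> lam j k / N j)" for jk
    let ?JK = "Sigma J K"
    have finJK: "finite ?JK" using fin by auto
    have jensen: "(1 - \<alpha>) * (\<Sum>jk\<in>?JK. w i jk * x jk powr \<alpha>) \<le> (1 - \<alpha>) * (d i / S) powr \<alpha>"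
      if i: "i \<in> I" for i
    proof -
      have "sum (w i) ?JK = (\<Sum>j\<in>J. \<Sum>k\<in>K j. N j / S * P i j k)"
        using fin by (simp add: w_def sum.Sigma)
      also have "\<dots> = (\<Sum>j\<in>J. N j / S * (\<Sum>k\<in>K j. P i j k))"
        by (simp add: sum_distrib_left)
      also have "\<dots> \<le> (\<Sum>j\<in>J. N j / S * 1)"
        using i row N0 S by (intro sum_mono mult_left_mono) auto
      also have "\<dots> = 1" using S by (simp add: S_def sum_divide_distrib[symmetric])
      finally have "sum (w i) ?JK \<le> 1" .
      moreover have "(\<Sum>jk\<in>?JK. w i jk * x jk) = d i / S"
      proof -
        have "(\<Sum>jk\<in>?JK. w i jk * x jk) = (\<Sum>j\<in>J. \<Sum>k\<in>K j. (N j / S * P i j k) * (lam j k / N j))"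
          using fin by (simp add: w_def x_def sum.Sigma case_prod_unfold)
        \<comment> \<open>Cancelling \<open>N j\<close> is harmless: where it vanishes, so does
          \<open>lam j k\<close>.\<close>
        also have "\<dots> = (\<Sum>j\<in>J. \<Sum>k\<in>K j. P i j k * lam j k / S)"
          using lam0 by (intro sum.cong refl) force
        also have "\<dots> = d i / S" by (simp add: d[OF i] sum_divide_distrib)
        finally show ?thesis .
      qed
      ultimately show ?thesis
        using powr_jensen[OF finJK \<alpha>, of "w i" x] i lam P N0 S by (fastforce simp: w_def x_def)
    qed
    have "(\<Sum>i\<in>I. \<Sum>jk\<in>?JK. w i jk * x jk powr \<alpha>) = (\<Sum>jk\<in>?JK. \<Sum>i\<in>I. w i jk * x jk powr \<alpha>)"
      by (rule sum.swap)
    also have "\<dots> = (\<Sum>j\<in>J. \<Sum>k\<in>K j. \<Sum>i\<in>I. N j / S * P i j k * (lam j k / N j) powr \<alpha>)"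
      using fin by (subst sum.Sigma) (simp_all add: w_def x_def case_prod_unfold)
    also have "\<dots> = (\<Sum>j\<in>J. \<Sum>k\<in>K j. N j / S * (lam j k / N j) powr \<alpha> * (\<Sum>i\<in>I. P i j k))"
      unfolding sum_distrib_left by (intro sum.cong refl) simp
    also have "\<dots> = (\<Sum>j\<in>J. \<Sum>k\<in>K j. N j / S * (lam j k / N j) powr \<alpha>)"
    proof (intro sum.cong refl)
      fix j k assume jk: "j \<in> J" "k \<in> K j"
      show "N j / S * (lam j k / N j) powr \<alpha> * (\<Sum>i\<in>I. P i j k) = N j / S * (lam j k / N j) powr \<alpha>"
        using column[OF jk] lam[OF jk] by (cases "lam j k = 0") auto
    qed
    also have "\<dots> = (\<Sum>j\<in>J. N j / S * ((\<Sum>k\<in>K j. lam j k powr \<alpha>) / N j powr \<alpha>))"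
      using lam N0 by (simp add: powr_divide sum_distrib_left sum_divide_distrib)
    also have "\<dots> = (\<Sum>j\<in>J. N j / S)"
      using \<alpha> by (intro sum.cong refl) (auto simp: N_def lp_norm_powr[symmetric])
    also have "\<dots> = 1" using S by (simp add: S_def sum_divide_distrib[symmetric])
    finally have one: "(\<Sum>i\<in>I. \<Sum>jk\<in>?JK. w i jk * x jk powr \<alpha>) = 1" .
    have "(1 - \<alpha>) * (\<Sum>i\<in>I. \<Sum>jk\<in>?JK. w i jk * x jk powr \<alpha>) \<le> (1 - \<alpha>) * (\<Sum>i\<in>I. (d i / S) powr \<alpha>)"
      unfolding sum_distrib_left[of "1 - \<alpha>" _ I] by (intro sum_mono jensen)
    also have "(\<Sum>i\<in>I. (d i / S) powr \<alpha>) = lp_norm \<alpha> I d powr \<alpha> / S powr \<alpha>"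
      using S d0 \<alpha> by (simp add: powr_divide sum_divide_distrib lp_norm_powr)
    finally have main: "(1 - \<alpha>) \<le> (1 - \<alpha>) * (lp_norm \<alpha> I d powr \<alpha> / S powr \<alpha>)"
      unfolding one by simp
    define X where "X = lp_norm \<alpha> I d powr \<alpha> / S powr \<alpha>"
    have mainX: "(1 - \<alpha>) \<le> (1 - \<alpha>) * X" using main by (simp add: X_def)
    \<comment> \<open>The \<alpha>-th root preserves order, but dividing by 1 - \<alpha> reverses
      the comparison when \<alpha> > 1; restoring the factor gives one statement for both
      ranges.\<close>
    consider "\<alpha> < 1" | "\<alpha> = 1" | "\<alpha> > 1" by linarith
    then have "(1 - \<alpha>) * S \<le> (1 - \<alpha>) * lp_norm \<alpha> I d"
    proof cases
      case 1
      with mainX have "1 \<le> X"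
        using mult_le_cancel_left_pos[of "1 - \<alpha>" 1 X] by simp
      with S have "S powr \<alpha> \<le> lp_norm \<alpha> I d powr \<alpha>" by (simp add: X_def)
      then have "S \<le> lp_norm \<alpha> I d"
        using \<alpha> lp_norm_nonneg[of \<alpha> I d] powr_less_mono2[of \<alpha> "lp_norm \<alpha> I d" S] by linarith
      with 1 show ?thesis by simp
    next
      case 3
      with mainX have "1 \<ge> X"
        using mult_le_cancel_left_neg[of "1 - \<alpha>" 1 X] by simp
      with S have "S powr \<alpha> \<ge> lp_norm \<alpha> I d powr \<alpha>" by (simp add: X_def)
      then have "S \<ge> lp_norm \<alpha> I d"
        using \<alpha> S powr_less_mono2[of \<alpha> S "lp_norm \<alpha> I d"] by linarith
      with 3 show ?thesis by simp
    qed simp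
    then show ?thesis by (simp add: S_def N_def)
  qed
qed

text \<open>Homogeneous of degree one: on the spectrum of an unnormalised outcome the probability
  \<open>sum d I\<close> is already included. If that sum is 0, the outer factor makes the value 0
  whatever the quotient by zero is.\<close>

definition gen_entropy :: "real \<Rightarrow> real \<Rightarrow> 'i set \<Rightarrow> ('i \<Rightarrow> real) \<Rightarrow> real" where
  "gen_entropy \<alpha> s I d = \<alpha> / (1 - \<alpha>) * (sum d I * dpow (s * \<alpha>) (lp_norm \<alpha> I d / sum d I))"

text \<open>All blocks are compared with the tangent of \<open>dpow\<close> at one common point y,
  the ratio belonging to the whole family. Weighted by p j and summed, the tangents give the entropy
  of \<open>d\<close> plus a multiple of the difference of the norms, because the traces agree; the
  hypothesis on the norms fixes the sign of that difference.\<close>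

lemma gen_entropy_mono:
  assumes fin: "finite I" "finite J" "\<And>j. j \<in> J \<Longrightarrow> finite (K j)"
    and \<alpha>: "\<alpha> > 0" and s: "\<alpha> < 1 \<and> s * \<alpha> \<le> 1 \<or> \<alpha> > 1 \<and> s * \<alpha> \<ge> 1"
    and lam: "\<And>j k. j \<in> J \<Longrightarrow> k \<in> K j \<Longrightarrow> lam j k \<ge> 0"
    and d: "\<And>i. i \<in> I \<Longrightarrow> d i \<ge> 0"
    and sum: "sum d I = (\<Sum>j\<in>J. sum (lam j) (K j))"
    and norm: "(1 - \<alpha>) * (\<Sum>j\<in>J. lp_norm \<alpha> (K j) (lam j)) \<le> (1 - \<alpha>) * lp_norm \<alpha> I d"
  shows "(\<Sum>j\<in>J. gen_entropy \<alpha> s (K j) (lam j)) \<le> gen_entropy \<alpha> s I d"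
proof -
  define p where "p j = sum (lam j) (K j)" for j
  define N where "N j = lp_norm \<alpha> (K j) (lam j)" for j
  have p0: "p j \<ge> 0" if "j \<in> J" for j using that lam by (auto simp: p_def intro!: sum_nonneg)
  have N_iff: "N j = 0 \<longleftrightarrow> p j = 0" if "j \<in> J" for j
    using that fin lam \<alpha> lp_norm_eq_0_iff[of "K j" "lam j" \<alpha>] sum_nonneg_eq_0_iff[of "K j" "lam j"]
    by (auto simp: N_def p_def)
  have N0: "N j \<ge> 0" for j by (simp add: N_def lp_norm_nonneg)
  show ?thesis
  proof (cases "sum d I = 0")
    case True
    then have "p j = 0" if "j \<in> J" for j
      using that p0 fin sum_nonneg_eq_0_iff[of J p] unfolding sum p_def by auto
    with True show ?thesis by (simp add: gen_entropy_def p_def)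
  next
    case False
    define y where "y = lp_norm \<alpha> I d / sum d I"
    have sum_d: "sum d I > 0" using False d sum_nonneg[of I d] by fastforce
    then have "lp_norm \<alpha> I d \<noteq> 0"
      using fin d \<alpha> False sum_nonneg_eq_0_iff[of I d] by (subst lp_norm_eq_0_iff) auto
    then have y: "y > 0" using sum_d lp_norm_nonneg[of \<alpha> I d] by (auto simp: y_def)
    have tangent: "gen_entropy \<alpha> s (K j) (lam j)
        \<le> \<alpha> / (1 - \<alpha>) * (p j * dpow (s * \<alpha>) y + y powr (s * \<alpha> - 1) * (N j - p j * y))"
      if j: "j \<in> J" for j
    proof (cases "p j = 0")
      case True
      then show ?thesis using N_iff[OF j] by (simp add: gen_entropy_def p_def)
    next
      case False
      then have pj: "p j > 0" and Nj: "N j > 0"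
        using p0[OF j] N0[of j] N_iff[OF j] by auto
      let ?r = "N j / p j"
      have eq: "p j * dpow (s * \<alpha>) y + y powr (s * \<alpha> - 1) * (N j - p j * y)
          = p j * (dpow (s * \<alpha>) y + y powr (s * \<alpha> - 1) * (?r - y))"
        using pj by (simp add: field_simps)
      \<comment> \<open>For \<alpha> > 1 the tangent lies below the convex \<open>dpow\<close>, but
        the prefactor is negative, so an upper bound results in both ranges.\<close>
      have le: "\<alpha> / (1 - \<alpha>) * dpow (s * \<alpha>) ?r
          \<le> \<alpha> / (1 - \<alpha>) * (dpow (s * \<alpha>) y + y powr (s * \<alpha> - 1) * (?r - y))"
      proof (cases "\<alpha> < 1")
        case True
        with s \<alpha> show ?thesis
          using pj Nj y by (intro mult_left_mono dpow_tangent) auto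
      next
        case False
        with s have "\<alpha> / (1 - \<alpha>) \<le> 0" "s * \<alpha> \<ge> 1" by (auto simp: divide_nonneg_neg)
        then show ?thesis
          using pj Nj y by (intro mult_left_mono_neg dpow_tangent) auto
      qed
      from mult_left_mono[OF this, of "p j"] pj show ?thesis
        unfolding eq by (simp add: gen_entropy_def p_def N_def mult_ac)
    qed
    have "(\<Sum>j\<in>J. gen_entropy \<alpha> s (K j) (lam j))
        \<le> (\<Sum>j\<in>J. \<alpha> / (1 - \<alpha>) * (p j * dpow (s * \<alpha>) y + y powr (s * \<alpha> - 1) * (N j - p j * y)))"
      by (intro sum_mono tangent)
    also have "\<dots> = \<alpha> / (1 - \<alpha>) * (sum p J * dpow (s * \<alpha>) y + y powr (s * \<alpha> - 1) * (sum N J - sum p J * y))"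
      by (simp add: sum_distrib_left sum_distrib_right sum.distrib sum_subtractf algebra_simps)
    also have "\<dots> = gen_entropy \<alpha> s I d + \<alpha> * y powr (s * \<alpha> - 1) * ((sum N J - lp_norm \<alpha> I d) / (1 - \<alpha>))"
    proof -
      have "sum p J = sum d I" by (simp add: sum p_def)
      moreover from this have "sum p J * y = lp_norm \<alpha> I d" using sum_d by (simp add: y_def)
      ultimately show ?thesis
        by (simp add: gen_entropy_def y_def[symmetric] algebra_simps add_divide_distrib diff_divide_distrib)
    qed
    also have "\<dots> \<le> gen_entropy \<alpha> s I d"
    proof -
      have "(sum N J - lp_norm \<alpha> I d) / (1 - \<alpha>) \<le> 0"
        using norm s
        by (auto simp: N_def mult_le_cancel_left divide_le_0_iff)
      then have "\<alpha> * y powr (s * \<alpha> - 1) * ((sum N J - lp_norm \<alpha> I d) / (1 - \<alpha>)) \<le> 0"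
        using \<alpha> by (intro mult_nonneg_nonpos) auto
      then show ?thesis by simp
    qed
    finally show ?thesis .
  qed
qed

text \<open>The weights deliver both inputs of the monotonicity argument: their column sums conserve
  the trace, where zero eigenvalues contribute nothing whatever their columns are, and the norm
  inequality is the Minkowski-type bound.\<close>

lemma gen_entropy_superadditive:
  fixes lam :: "'j \<Rightarrow> 'k \<Rightarrow> real" and P :: "'i \<Rightarrow> 'j \<Rightarrow> 'k \<Rightarrow> real"
  assumes fin: "finite I" "finite J" "\<And>j. j \<in> J \<Longrightarrow> finite (K j)"
    and \<alpha>: "\<alpha> > 0" and s: "\<alpha> < 1 \<and> s * \<alpha> \<le> 1 \<or> \<alpha> > 1 \<and> s * \<alpha> \<ge> 1"
    and lam: "\<And>j k. j \<in> J \<Longrightarrow> k \<in> K j \<Longrightarrow> lam j k \<ge> 0"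
    and P: "\<And>i j k. i \<in> I \<Longrightarrow> j \<in> J \<Longrightarrow> k \<in> K j \<Longrightarrow> P i j k \<ge> 0"
    and row: "\<And>i j. i \<in> I \<Longrightarrow> j \<in> J \<Longrightarrow> (\<Sum>k\<in>K j. P i j k) \<le> 1"
    and column: "\<And>j k. j \<in> J \<Longrightarrow> k \<in> K j \<Longrightarrow> lam j k > 0 \<Longrightarrow> (\<Sum>i\<in>I. P i j k) = 1"
    and d: "\<And>i. i \<in> I \<Longrightarrow> d i = (\<Sum>j\<in>J. \<Sum>k\<in>K j. P i j k * lam j k)"
  shows "(\<Sum>j\<in>J. gen_entropy \<alpha> s (K j) (lam j)) \<le> gen_entropy \<alpha> s I d"
proof (rule gen_entropy_mono[OF fin \<alpha> s lam])
  show "d i \<ge> 0" if "i \<in> I" for i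
    unfolding d[OF that] using that lam P by (intro sum_nonneg) auto
  have "sum d I = (\<Sum>i\<in>I. \<Sum>j\<in>J. \<Sum>k\<in>K j. P i j k * lam j k)"
    using d by simp
  also have "\<dots> = (\<Sum>j\<in>J. \<Sum>k\<in>K j. \<Sum>i\<in>I. P i j k * lam j k)"
    by (subst sum.swap) (intro sum.cong refl sum.swap)
  also have "\<dots> = (\<Sum>j\<in>J. \<Sum>k\<in>K j. lam j k)"
  proof (intro sum.cong refl)
    fix j k assume jk: "j \<in> J" "k \<in> K j"
    show "(\<Sum>i\<in>I. P i j k * lam j k) = lam j k"
      using column[OF jk] lam[OF jk] by (cases "lam j k = 0") (auto simp: sum_distrib_right[symmetric])
  qed
  finally show "sum d I = (\<Sum>j\<in>J. sum (lam j) (K j))" .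
  show "(1 - \<alpha>) * (\<Sum>j\<in>J. lp_norm \<alpha> (K j) (lam j)) \<le> (1 - \<alpha>) * lp_norm \<alpha> I d"
    by (rule lp_norm_superadditive[OF fin \<alpha> lam P row column d])
qed auto

section \<open>Spectral theorem for Hermitian matrices\<close>

lemma mat_adjoint_index:
  "mat_adjoint A = mat (dim_col A) (dim_row A) (\<lambda>(i, j). cnj (A $$ (j, i)))"
  by (rule eq_matI) (auto simp: mat_adjoint_def mat_of_rows_def)

lemma mat_adjoint_carrier [simp, intro]:
  "A \<in> carrier_mat n m \<Longrightarrow> mat_adjoint (A :: complex mat) \<in> carrier_mat m n"
  by (simp add: mat_adjoint_index)

lemma dim_mat_adjoint [simp]:
  "dim_row (mat_adjoint (A :: complex mat)) = dim_col A"
  "dim_col (mat_adjoint (A :: complex mat)) = dim_row A"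
  by (simp_all add: mat_adjoint_index)

lemma index_mat_adjoint [simp]:
  "i < dim_col A \<Longrightarrow> j < dim_row A \<Longrightarrow> mat_adjoint A $$ (i, j) = cnj (A $$ (j, i))"
  by (simp add: mat_adjoint_index)

lemma mat_adjoint_adjoint [simp]: "mat_adjoint (mat_adjoint A) = (A :: complex mat)"
  by (rule eq_matI) auto

lemma mat_adjoint_one [simp]: "mat_adjoint (1\<^sub>m n) = (1\<^sub>m n :: complex mat)"
  by (rule eq_matI) auto

lemma index_mult_sum:
  "i < dim_row A \<Longrightarrow> j < dim_col B \<Longrightarrow> (A * B) $$ (i, j) = (\<Sum>k<dim_row B. A $$ (i, k) * B $$ (k, j))"
  if "dim_col A = dim_row B"
  using that by (auto simp: scalar_prod_def atLeast0LessThan intro!: sum.cong)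

lemma mat_adjoint_mult:
  assumes "A \<in> carrier_mat n m" "B \<in> carrier_mat m l"
  shows "mat_adjoint (A * B) = mat_adjoint B * mat_adjoint (A :: complex mat)"
  using assms by (intro eq_matI) (auto simp: index_mult_sum mult.commute cnj_sum simp del: index_mult_mat(1))

definition is_unitary :: "nat \<Rightarrow> complex mat \<Rightarrow> bool" where
  "is_unitary n U \<longleftrightarrow> U \<in> carrier_mat n n \<and> mat_adjoint U * U = 1\<^sub>m n"

lemma is_unitaryD:
  assumes "is_unitary n U"
  shows "U \<in> carrier_mat n n" "mat_adjoint U * U = 1\<^sub>m n" "U * mat_adjoint U = 1\<^sub>m n"
  using assms mat_mult_left_right_inverse[of "mat_adjoint U" n U] by (auto simp: is_unitary_def)

lemma is_unitary_mult:
  assumes "is_unitary n U" "is_unitary n V"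
  shows "is_unitary n (U * V)"
proof -
  note U = is_unitaryD[OF assms(1)] and V = is_unitaryD[OF assms(2)]
  have "mat_adjoint (U * V) * (U * V) = mat_adjoint V * (mat_adjoint U * (U * V))"
    using U(1) V(1) by (simp add: mat_adjoint_mult[of U n n V n] assoc_mult_mat[of _ n n _ n _ n])
  also have "mat_adjoint U * (U * V) = V"
    using U V(1) by (simp flip: assoc_mult_mat[of "mat_adjoint U" n n U n V n])
  finally show ?thesis using U V by (simp add: is_unitary_def)
qed

lemma is_unitary_adjoint:
  assumes "is_unitary n U"
  shows "is_unitary n (mat_adjoint U)"
  using is_unitaryD[OF assms] by (simp add: is_unitary_def)

lemma unitary_column_extension:
  assumes v: "v \<in> carrier_vec n" "v \<noteq> 0\<^sub>v n"
  obtains W c where "is_unitary n W" "c \<noteq> 0" "\<And>i. i < n \<Longrightarrow> W $$ (i, 0) = c * v $ i"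
proof -
  interpret cof_vec_space n "TYPE(complex)" .
  define b where "b = basis_completion v"
  define ws where "ws = gram_schmidt n b"
  have n: "n > 0" using v by (cases n) auto
  note b = basis_completion[OF v, folded b_def]
  then obtain vs where bv: "b = v # vs" using n by (cases b) auto
  note gs = gram_schmidt_result[OF b(2,4,5) ws_def]
  have len: "length ws = n" using gs(4) b(6) by simp
  have hd: "ws ! 0 = v"
    using gram_schmidt_hd[OF v(1), of vs, folded bv, folded ws_def] len n by (cases ws) auto
  have wsc: "ws ! i \<in> carrier_vec n" if "i < n" for i using gs(3) len that by auto
  define r where "r i = sqrt (norm_sq (ws ! i))" for i
  define W where "W = mat n n (\<lambda>(i, j). complex_of_real (1 / r j) * ws ! j $ i)"
  have W: "W \<in> carrier_mat n n" by (simp add: W_def)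
  have self: "ws ! i \<bullet>c ws ! i = complex_of_real (norm_sq (ws ! i))" "norm_sq (ws ! i) > 0" if i: "i < n" for i
  proof -
    have *: "ws ! i \<bullet>c ws ! i = complex_of_real (\<Sum>k<n. (cmod (ws ! i $ k))\<^sup>2)"
      using wsc[OF i] unfolding of_real_sum complex_norm_square
      by (simp add: scalar_prod_def atLeast0LessThan)
    then show "ws ! i \<bullet>c ws ! i = complex_of_real (norm_sq (ws ! i))" by (simp add: norm_sq_def)
    have "ws ! i \<bullet>c ws ! i \<noteq> 0" using corthogonalD[OF gs(2)] i len by blast
    then have "(\<Sum>k<n. (cmod (ws ! i $ k))\<^sup>2) \<noteq> 0" unfolding * of_real_eq_0_iff .
    moreover have "norm_sq (ws ! i) = (\<Sum>k<n. (cmod (ws ! i $ k))\<^sup>2)"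
      unfolding norm_sq_def * by (rule Re_complex_of_real)
    ultimately show "norm_sq (ws ! i) > 0" by (simp add: less_le sum_nonneg)
  qed
  have "mat_adjoint W * W = 1\<^sub>m n"
  proof (intro eq_matI)
    fix i j assume ij: "i < dim_row (1\<^sub>m n :: complex mat)" "j < dim_col (1\<^sub>m n :: complex mat)"
    have "(mat_adjoint W * W) $$ (i, j) = (\<Sum>k<n. cnj (W $$ (k, i)) * W $$ (k, j))"
      using ij W by (subst index_mult_sum) auto
    also have "\<dots> = complex_of_real (1 / r i * (1 / r j)) * (\<Sum>k<n. ws ! j $ k * cnj (ws ! i $ k))"
      using ij by (simp add: W_def sum_distrib_left mult_ac)
    also have "(\<Sum>k<n. ws ! j $ k * cnj (ws ! i $ k)) = ws ! j \<bullet>c ws ! i"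
      using wsc[of i] wsc[of j] ij by (simp add: scalar_prod_def atLeast0LessThan)
    also have "complex_of_real (1 / r i * (1 / r j)) * (ws ! j \<bullet>c ws ! i) = 1\<^sub>m n $$ (i, j)"
    proof (cases "i = j")
      case True
      then show ?thesis using ij self[of j] by (auto simp: r_def simp flip: of_real_mult)
    next
      case False
      then have "ws ! j \<bullet>c ws ! i = 0" using corthogonalD[OF gs(2), of j i] ij len by auto
      then show ?thesis using False ij by simp
    qed
    finally show "(mat_adjoint W * W) $$ (i, j) = 1\<^sub>m n $$ (i, j)" .
  qed (use W in auto)
  then have "is_unitary n W" using W by (simp add: is_unitary_def)
  then show thesis
    by (rule that[of W "complex_of_real (1 / r 0)"]) (use n self[of 0] hd in \<open>auto simp: W_def r_def\<close>)
qed

lemma mat_adjoint_conjugation: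
  fixes A :: "complex mat"
  assumes "A \<in> carrier_mat n n" "W \<in> carrier_mat n m"
  shows "mat_adjoint (mat_adjoint W * A * W) = mat_adjoint W * mat_adjoint A * W"
proof -
  have "mat_adjoint (mat_adjoint W * A * W) = mat_adjoint W * (mat_adjoint A * W)"
    using assms mat_adjoint_mult[of "mat_adjoint W * A" m n W m] mat_adjoint_mult[of "mat_adjoint W" m n A n]
    by (simp add: mult_carrier_mat[of _ m n])
  also have "\<dots> = mat_adjoint W * mat_adjoint A * W"
    using assms assoc_mult_mat[of "mat_adjoint W" m n "mat_adjoint A" n W m] by simp
  finally show ?thesis .
qed

lemma mat_conjugation_mult:
  fixes A :: "complex mat"
  assumes "A \<in> carrier_mat n n" "W \<in> carrier_mat n m" "Y \<in> carrier_mat m l"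
  shows "mat_adjoint (W * Y) * A * (W * Y) = mat_adjoint Y * (mat_adjoint W * A * W) * Y"
proof -
  have "mat_adjoint (W * Y) * A * (W * Y) = mat_adjoint Y * mat_adjoint W * A * W * Y"
    using assms assoc_mult_mat[of "mat_adjoint Y * mat_adjoint W * A" l n W m Y l]
    by (simp add: mat_adjoint_mult[of W n m Y l] mult_carrier_mat[of _ l n] mult_carrier_mat[of _ l m])
  also have "mat_adjoint Y * mat_adjoint W * A = mat_adjoint Y * (mat_adjoint W * A)"
    using assms by (intro assoc_mult_mat) auto
  also have "\<dots> * W = mat_adjoint Y * (mat_adjoint W * A * W)"
    using assms by (intro assoc_mult_mat) auto
  finally show ?thesis .
qed

text \<open>Deflation: in a unitary basis whose first vector is an eigenvector, the first column of
  the matrix vanishes below the corner, and hermiticity then clears the first row. The remaining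
  block C is again Hermitian, and its diagonalising unitary V is bordered by 1 to give Y.\<close>

lemma hermitian_spectral:
  assumes "A \<in> carrier_mat n n" "mat_adjoint A = A"
  obtains U d where "is_unitary n U"
    "mat_adjoint U * A * U = mat_diag n (\<lambda>i. complex_of_real (d i))"
  using assms
proof (induction n arbitrary: A thesis)
  case 0
  show ?case by (rule "0"(1)[of "1\<^sub>m 0"]) (use "0"(2) in \<open>auto simp: is_unitary_def mat_diag_def intro!: eq_matI\<close>)
next
  case (Suc n)
  note A = \<open>A \<in> carrier_mat (Suc n) (Suc n)\<close> and herm = \<open>mat_adjoint A = A\<close>
  obtain e v where "eigenvector A v e"
    using spectrum_non_empty[OF A] by (auto simp: spectrum_def eigenvalue_def)
  then have v: "v \<in> carrier_vec (Suc n)" "v \<noteq> 0\<^sub>v (Suc n)" "A *\<^sub>v v = e \<cdot>\<^sub>v v"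
    using A by (auto simp: eigenvector_def)
  obtain W c where uW: "is_unitary (Suc n) W" and "c \<noteq> 0"
    and Wcol: "\<And>i. i < Suc n \<Longrightarrow> W $$ (i, 0) = c * v $ i"
    using unitary_column_extension[OF v(1,2)] by blast
  note W = is_unitaryD[OF uW]
  define B where "B = mat_adjoint W * A * W"
  have Bc: "B \<in> carrier_mat (Suc n) (Suc n)" unfolding B_def using A W(1) by (intro mult_carrier_mat) auto
  have Bherm: "mat_adjoint B = B"
    unfolding B_def mat_adjoint_conjugation[OF A W(1)] herm ..
  have AW0: "(A * W) $$ (i, 0) = e * W $$ (i, 0)" if i: "i < Suc n" for i
  proof -
    have "(A * W) $$ (i, 0) = c * (\<Sum>k<Suc n. A $$ (i, k) * v $ k)"
      using A W(1) i Wcol by (subst index_mult_sum) (auto simp: sum_distrib_left mult_ac simp del: sum.lessThan_Suc intro!: sum.cong)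
    also have "(\<Sum>k<Suc n. A $$ (i, k) * v $ k) = (A *\<^sub>v v) $ i"
      using A v(1) i by (auto simp: scalar_prod_def atLeast0LessThan intro!: sum.cong)
    finally show ?thesis using v i Wcol by simp
  qed
  have B0: "B $$ (i, 0) = (if i = 0 then e else 0)" if i: "i < Suc n" for i
  proof -
    have "B $$ (i, 0) = (mat_adjoint W * (A * W)) $$ (i, 0)"
      using A W(1) by (simp add: B_def assoc_mult_mat[of "mat_adjoint W" "Suc n" "Suc n" A "Suc n" W "Suc n"])
    also have "\<dots> = e * (\<Sum>k<Suc n. mat_adjoint W $$ (i, k) * W $$ (k, 0))"
      using A W(1) i AW0
      by (subst index_mult_sum) (auto simp: sum_distrib_left mult_ac simp del: index_mult_mat(1) sum.lessThan_Suc intro!: sum.cong)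
    also have "(\<Sum>k<Suc n. mat_adjoint W $$ (i, k) * W $$ (k, 0)) = (mat_adjoint W * W) $$ (i, 0)"
      using W(1) i by (subst index_mult_sum) auto
    finally show ?thesis using W(2) i by simp
  qed
  have B_sym: "B $$ (i, j) = cnj (B $$ (j, i))" if "i < Suc n" "j < Suc n" for i j
    using arg_cong[OF Bherm, of "\<lambda>M. M $$ (i, j)"] Bc that by simp
  define C where "C = mat n n (\<lambda>(i, j). B $$ (Suc i, Suc j))"
  have Cc: "C \<in> carrier_mat n n" by (simp add: C_def)
  have "mat_adjoint C = C" by (intro eq_matI) (auto simp: C_def intro!: B_sym[symmetric])
  then obtain V d where uV: "is_unitary n V" and Vd: "mat_adjoint V * C * V = mat_diag n (\<lambda>i. complex_of_real (d i))"
    using Suc.IH Cc by metis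
  note V = is_unitaryD[OF uV]
  \<comment> \<open>The eigenvalue is the corner entry of B, and diagonal entries of a Hermitian
    matrix are real.\<close>
  have e: "e = complex_of_real (Re e)"
    using B_sym[of 0 0] B0[of 0] by (auto simp: complex_eq_iff)
  define E where "E = mat 1 1 (\<lambda>_. e)"
  define Y where "Y = four_block_mat (1\<^sub>m 1) (0\<^sub>m 1 n) (0\<^sub>m n 1) V"
  have Yc: "Y \<in> carrier_mat (Suc n) (Suc n)" using V(1) by (auto simp: Y_def)
  have Yadj: "mat_adjoint Y = four_block_mat (1\<^sub>m 1) (0\<^sub>m 1 n) (0\<^sub>m n 1) (mat_adjoint V)"
    using V(1) by (intro eq_matI) (auto simp: Y_def)
  have Bblock: "B = four_block_mat E (0\<^sub>m 1 n) (0\<^sub>m n 1) C"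
  proof (intro eq_matI)
    fix i j assume "i < dim_row (four_block_mat E (0\<^sub>m 1 n) (0\<^sub>m n 1) C)"
      "j < dim_col (four_block_mat E (0\<^sub>m 1 n) (0\<^sub>m n 1) C)"
    then have "i < Suc n" "j < Suc n" by (auto simp: E_def C_def)
    then show "B $$ (i, j) = four_block_mat E (0\<^sub>m 1 n) (0\<^sub>m n 1) C $$ (i, j)"
      using B0 B_sym[of 0 j] by (cases i; cases j) (auto simp: E_def C_def)
  qed (use Bc in \<open>auto simp: E_def C_def\<close>)
  have Ec: "E \<in> carrier_mat 1 1" by (simp add: E_def)
  have uY: "is_unitary (Suc n) Y"
  proof -
    have "mat_adjoint Y * Y = four_block_mat (1\<^sub>m 1) (0\<^sub>m 1 n) (0\<^sub>m n 1) (1\<^sub>m n)"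
      unfolding Yadj unfolding Y_def
      by (subst mult_four_block_mat[of _ 1 1 _ n _ n _ _ 1 _ n]) (use V in auto)
    then show ?thesis using Yc by (simp add: is_unitary_def)
  qed
  have "mat_adjoint Y * B * Y = four_block_mat E (0\<^sub>m 1 n) (0\<^sub>m n 1) (mat_adjoint V * C * V)"
  proof -
    have "mat_adjoint Y * B = four_block_mat E (0\<^sub>m 1 n) (0\<^sub>m n 1) (mat_adjoint V * C)"
      unfolding Yadj Bblock
      by (subst mult_four_block_mat[of _ 1 1 _ n _ n _ _ 1 _ n]) (use V(1) Cc Ec in auto)
    then show ?thesis unfolding Y_def
      by (simp, subst mult_four_block_mat[of _ 1 1 _ n _ n _ _ 1 _ n]) (use V(1) Cc Ec in auto)
  qed
  also have "\<dots> = mat_diag (Suc n) (\<lambda>i. complex_of_real (case i of 0 \<Rightarrow> Re e | Suc i \<Rightarrow> d i))"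
    unfolding Vd
  proof (intro eq_matI)
    fix i j assume "i < dim_row (mat_diag (Suc n) (\<lambda>i. complex_of_real (case i of 0 \<Rightarrow> Re e | Suc i \<Rightarrow> d i)))"
      "j < dim_col (mat_diag (Suc n) (\<lambda>i. complex_of_real (case i of 0 \<Rightarrow> Re e | Suc i \<Rightarrow> d i)))"
    then have "i < Suc n" "j < Suc n" by (auto simp: mat_diag_def)
    then show "four_block_mat E (0\<^sub>m 1 n) (0\<^sub>m n 1) (mat_diag n (\<lambda>i. complex_of_real (d i))) $$ (i, j) =
       mat_diag (Suc n) (\<lambda>i. complex_of_real (case i of 0 \<Rightarrow> Re e | Suc i \<Rightarrow> d i)) $$ (i, j)"
      using e by (cases i; cases j) (auto simp: E_def mat_diag_def)
  qed (auto simp: E_def mat_diag_def)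
  also have "mat_adjoint Y * B * Y = mat_adjoint (W * Y) * A * (W * Y)"
    unfolding B_def mat_conjugation_mult[OF A W(1) Yc] ..
  finally show ?case using Suc.prems(1) is_unitary_mult[OF uW uY] by blast
qed

section \<open>Powers of positive semidefinite matrices\<close>

definition spectral_rep :: "nat \<Rightarrow> complex mat \<Rightarrow> complex mat \<Rightarrow> (nat \<Rightarrow> real) \<Rightarrow> bool" where
  "spectral_rep n A U d \<longleftrightarrow> is_unitary n U \<and> (\<forall>i<n. 0 \<le> d i) \<and>
     A = U * mat_diag n (\<lambda>i. complex_of_real (d i)) * mat_adjoint U"

lemma index_conjugated_diag:
  assumes "U \<in> carrier_mat m n" "k < m" "l < m"
  shows "(U * mat_diag n f * mat_adjoint U) $$ (k, l) = (\<Sum>i<n. U $$ (k, i) * f i * cnj (U $$ (l, i)))"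
  using assms
  by (subst index_mult_sum) (auto simp: mat_diag_mult_right[of U m n] simp del: index_mult_mat(1) intro!: sum.cong)

lemma index_conjugation:
  assumes "A \<in> carrier_mat n n" "U \<in> carrier_mat n m" "i < m" "j < m"
  shows "(mat_adjoint U * A * U) $$ (i, j) = (\<Sum>a<n. \<Sum>b<n. cnj (U $$ (a, i)) * A $$ (a, b) * U $$ (b, j))"
proof -
  have "(mat_adjoint U * A * U) $$ (i, j) = (\<Sum>b<n. (mat_adjoint U * A) $$ (i, b) * U $$ (b, j))"
    using assms by (subst index_mult_sum) auto
  also have "\<dots> = (\<Sum>b<n. \<Sum>a<n. cnj (U $$ (a, i)) * A $$ (a, b) * U $$ (b, j))"
    using assms by (intro sum.cong refl) (subst index_mult_sum, auto simp: sum_distrib_right simp del: index_mult_mat(1))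
  finally show ?thesis by (subst sum.swap)
qed

lemma unitary_column_norm:
  assumes "is_unitary n U" "i < n"
  shows "(\<Sum>k<n. (cmod (U $$ (k, i)))\<^sup>2) = 1"
proof -
  note U = is_unitaryD[OF assms(1)]
  have "complex_of_real (\<Sum>k<n. (cmod (U $$ (k, i)))\<^sup>2) = (mat_adjoint U * U) $$ (i, i)"
    unfolding of_real_sum complex_norm_square
    using U(1) assms(2) by (subst index_mult_sum) (auto simp: mult.commute)
  then show ?thesis using U(2) assms(2) by (simp del: of_real_sum)
qed

lemma unitary_row_norm:
  assumes "is_unitary n U" "k < n"
  shows "(\<Sum>i<n. (cmod (U $$ (k, i)))\<^sup>2) = 1"
  using unitary_column_norm[OF is_unitary_adjoint[OF assms(1)] assms(2)] assms is_unitaryD(1)[OF assms(1)]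
  by simp

lemma spectral_rep_diag:
  assumes "spectral_rep n A U d"
  shows "mat_adjoint U * A * U = mat_diag n (\<lambda>i. complex_of_real (d i))"
proof -
  let ?D = "mat_diag n (\<lambda>i. complex_of_real (d i))"
  have u: "is_unitary n U" and A: "A = U * ?D * mat_adjoint U"
    using assms by (auto simp: spectral_rep_def)
  note U = is_unitaryD[OF u]
  show ?thesis
    using mat_conjugation_mult[of ?D n "mat_adjoint U" n U n] U
    by (simp add: A left_mult_one_mat[of _ n n] right_mult_one_mat[of _ n n])
qed

lemma spectral_rep_carrier: "spectral_rep n A U d \<Longrightarrow> A \<in> carrier_mat n n"
  using is_unitaryD(1)[of n U] unfolding spectral_rep_def by (auto intro!: mult_carrier_mat[of _ n n _ n])

text \<open>W = V^* U intertwines the two diagonal matrices, that is, an entry of W at (i, j) can be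
  nonzero only if d j = e i. Then also f (d j) = f (e i), so the same W intertwines the transformed
  diagonals. This justifies the definite description in \<open>mat_powr\<close>.\<close>

lemma functional_calculus_unique:
  assumes 1: "spectral_rep n A U d" and 2: "spectral_rep n A V e"
  shows "U * mat_diag n (\<lambda>i. complex_of_real (f (d i))) * mat_adjoint U =
         V * mat_diag n (\<lambda>i. complex_of_real (f (e i))) * mat_adjoint V"
proof -
  let ?D = "\<lambda>d. mat_diag n (\<lambda>i. complex_of_real (d i))"
  have uU: "is_unitary n U" and A1: "A = U * ?D d * mat_adjoint U" using 1 by (auto simp: spectral_rep_def)
  have uV: "is_unitary n V" and A2: "A = V * ?D e * mat_adjoint V" using 2 by (auto simp: spectral_rep_def)
  note U = is_unitaryD[OF uU] and V = is_unitaryD[OF uV]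
  note assoc = assoc_mult_mat[of _ n n _ n _ n]
  note car = U(1) V(1) mat_adjoint_carrier[OF U(1)] mat_adjoint_carrier[OF V(1)] mult_carrier_mat[of _ n n _ n] mat_diag_dim
  define W where "W = mat_adjoint V * U"
  have W: "W \<in> carrier_mat n n" unfolding W_def by (intro car)
  have "W * ?D d = mat_adjoint V * (U * ?D d * mat_adjoint U) * U"
    unfolding W_def by (simp only: assoc car U right_mult_one_mat[of _ n n])
  also have "\<dots> = mat_adjoint V * V * (?D e * (mat_adjoint V * U))"
    unfolding A1[symmetric] unfolding A2 by (simp only: assoc car)
  finally have WD: "W * ?D d = ?D e * W"
    unfolding W_def[symmetric] V by (simp only: left_mult_one_mat[of _ n n] car W)
  have entry: "W $$ (i, j) * d j = e i * W $$ (i, j)" if "i < n" "j < n" for i j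
    using arg_cong[OF WD, of "\<lambda>M. M $$ (i, j)"] that W
    by (simp add: mat_diag_mult_left[of _ n n] mat_diag_mult_right[of _ n n])
  have "W * ?D (f \<circ> d) = ?D (f \<circ> e) * W"
  proof (intro eq_matI)
    fix i j assume "i < dim_row (?D (f \<circ> e) * W)" "j < dim_col (?D (f \<circ> e) * W)"
    then have ij: "i < n" "j < n" using W by (auto simp: mat_diag_def)
    then show "(W * ?D (f \<circ> d)) $$ (i, j) = (?D (f \<circ> e) * W) $$ (i, j)"
      using entry[OF ij] W by (cases "W $$ (i, j) = 0") (auto simp: mat_diag_mult_left[of _ n n] mat_diag_mult_right[of _ n n])
  qed (use W in \<open>auto simp: mat_diag_def\<close>)
  note WfD = this
  have "U * ?D (f \<circ> d) * mat_adjoint U = V * mat_adjoint V * (U * ?D (f \<circ> d) * mat_adjoint U)"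
    by (simp only: V left_mult_one_mat[of _ n n] car)
  also have "\<dots> = V * (W * ?D (f \<circ> d)) * mat_adjoint U"
    unfolding W_def by (simp only: assoc car)
  also have "\<dots> = V * ?D (f \<circ> e) * mat_adjoint V * (U * mat_adjoint U)"
    unfolding WfD unfolding W_def by (simp only: assoc car)
  also have "\<dots> = V * ?D (f \<circ> e) * mat_adjoint V"
    by (simp only: U right_mult_one_mat[of _ n n] car)
  finally show ?thesis by simp
qed

lemma mat_powr_spectral:
  assumes "spectral_rep n A U d"
  shows "mat_powr A a = U * mat_diag n (\<lambda>i. complex_of_real (d i powr a)) * mat_adjoint U"
proof -
  have n: "dim_row A = n" using spectral_rep_carrier[OF assms] by auto
  show ?thesis unfolding mat_powr_def n Let_def
  proof (rule the_equality)
    show "\<exists>U' d'. U' \<in> carrier_mat n n \<and> mat_adjoint U' * U' = 1\<^sub>m n \<and> (\<forall>i<n. 0 \<le> d' i) \<and>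
       A = U' * mat_diag n (\<lambda>i. complex_of_real (d' i)) * mat_adjoint U' \<and>
       U * mat_diag n (\<lambda>i. complex_of_real (d i powr a)) * mat_adjoint U =
       U' * mat_diag n (\<lambda>i. complex_of_real (d' i powr a)) * mat_adjoint U'"
      using assms unfolding spectral_rep_def is_unitary_def by blast
  next
    fix X
    assume "\<exists>V (e :: nat \<Rightarrow> real). V \<in> carrier_mat n n \<and> mat_adjoint V * V = 1\<^sub>m n \<and> (\<forall>i<n. 0 \<le> e i) \<and>
       A = V * mat_diag n (\<lambda>i. complex_of_real (e i)) * mat_adjoint V \<and>
       X = V * mat_diag n (\<lambda>i. complex_of_real (e i powr a)) * mat_adjoint V"
    then obtain V e where "spectral_rep n A V e"
      and X: "X = V * mat_diag n (\<lambda>i. complex_of_real (e i powr a)) * mat_adjoint V"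
      unfolding spectral_rep_def is_unitary_def by blast
    then show "X = U * mat_diag n (\<lambda>i. complex_of_real (d i powr a)) * mat_adjoint U"
      using functional_calculus_unique[OF assms, of V e "\<lambda>x. x powr a"] by simp
  qed
qed

lemma trace_conjugated_diag:
  assumes "is_unitary n U"
  shows "mat_trace (U * mat_diag n f * mat_adjoint U) = (\<Sum>i<n. f i)"
proof -
  note U = is_unitaryD[OF assms]
  have "mat_trace (U * mat_diag n f * mat_adjoint U) = (\<Sum>k<n. \<Sum>i<n. complex_of_real ((cmod (U $$ (k, i)))\<^sup>2) * f i)"
    unfolding mat_trace_def complex_norm_square using U(1)
    by (intro sum.cong) (auto simp: index_conjugated_diag simp del: index_mult_mat(1) intro!: sum.cong)
  also have "\<dots> = (\<Sum>i<n. complex_of_real (\<Sum>k<n. (cmod (U $$ (k, i)))\<^sup>2) * f i)"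
    by (subst sum.swap) (simp add: sum_distrib_right)
  finally show ?thesis using unitary_column_norm[OF assms] by (simp del: of_real_sum)
qed

lemma trace_mat_powr_spectral:
  assumes "spectral_rep n A U d"
  shows "Re (mat_trace (mat_powr A a)) = (\<Sum>i<n. d i powr a)"
  using assms unfolding mat_powr_spectral[OF assms] by (simp add: trace_conjugated_diag spectral_rep_def)

lemma trace_spectral:
  assumes "spectral_rep n A U d"
  shows "Re (mat_trace A) = (\<Sum>i<n. d i)"
proof -
  have "is_unitary n U" "A = U * mat_diag n (\<lambda>i. complex_of_real (d i)) * mat_adjoint U"
    using assms by (auto simp: spectral_rep_def)
  then show ?thesis by (simp add: trace_conjugated_diag)
qed

section \<open>Spectra of Gram matrices\<close>

lemma index_gram:
  assumes "X \<in> carrier_mat n m" "i < n" "j < n"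
  shows "(X * mat_adjoint X) $$ (i, j) = (\<Sum>a<m. X $$ (i, a) * cnj (X $$ (j, a)))"
  using assms by (subst index_mult_sum) auto

text \<open>Diagonalising X X^* makes the rows of U^* X orthogonal, with the eigenvalues as squared
  norms. This gives nonnegativity; the explicit formula serves the study of product vectors, where a
  zero eigenvalue must annihilate a whole row.\<close>

lemma gram_spectral:
  assumes X: "X \<in> carrier_mat n m"
  obtains U d where "spectral_rep n (X * mat_adjoint X) U d"
    "\<And>i. i < n \<Longrightarrow> d i = (\<Sum>a<m. (cmod ((mat_adjoint U * X) $$ (i, a)))\<^sup>2)"
proof -
  let ?A = "X * mat_adjoint X"
  have A: "?A \<in> carrier_mat n n" using X by (intro mult_carrier_mat) auto
  have "mat_adjoint ?A = ?A" using X by (simp add: mat_adjoint_mult[of X n m "mat_adjoint X" n])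
  from hermitian_spectral[OF A this] obtain U d where u: "is_unitary n U"
    and D: "mat_adjoint U * ?A * U = mat_diag n (\<lambda>i. complex_of_real (d i))" by blast
  note U = is_unitaryD[OF u]
  let ?Y = "mat_adjoint U * X"
  have Y: "?Y \<in> carrier_mat n m" using U(1) X by (intro mult_carrier_mat) auto
  have "?Y * mat_adjoint ?Y = mat_adjoint U * ?A * U"
  proof -
    have "?Y * mat_adjoint ?Y = mat_adjoint U * X * (mat_adjoint X * U)"
      using U(1) X by (simp add: mat_adjoint_mult[of "mat_adjoint U" n n X m])
    also have "\<dots> = mat_adjoint U * X * mat_adjoint X * U"
      using U(1) X by (intro assoc_mult_mat[symmetric]) auto
    also have "mat_adjoint U * X * mat_adjoint X = mat_adjoint U * ?A"
      using U(1) X by (intro assoc_mult_mat) auto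
    finally show ?thesis .
  qed
  then have YY: "?Y * mat_adjoint ?Y = mat_diag n (\<lambda>i. complex_of_real (d i))" using D by simp
  have d: "d i = (\<Sum>a<m. (cmod (?Y $$ (i, a)))\<^sup>2)" if i: "i < n" for i
  proof -
    have "complex_of_real (d i) = complex_of_real (\<Sum>a<m. (cmod (?Y $$ (i, a)))\<^sup>2)"
      unfolding of_real_sum complex_norm_square index_gram[OF Y i i, symmetric] YY
      using i by (simp add: mat_diag_def)
    then show ?thesis unfolding of_real_eq_iff .
  qed
  have "U * mat_diag n (\<lambda>i. complex_of_real (d i)) * mat_adjoint U
    = mat_adjoint (mat_adjoint U) * (mat_adjoint U * ?A * U) * mat_adjoint U"
    by (simp add: D)
  also have "\<dots> = mat_adjoint (U * mat_adjoint U) * ?A * (U * mat_adjoint U)"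
    using mat_conjugation_mult[OF A U(1) mat_adjoint_carrier[OF U(1)]] by simp
  also have "\<dots> = ?A" using A by (simp add: U left_mult_one_mat[of _ n n] right_mult_one_mat[of _ n n])
  finally have "spectral_rep n ?A U d"
    using u d by (auto simp: spectral_rep_def intro!: sum_nonneg)
  with d show thesis using that by blast
qed

lemma gram_spectral_exists:
  assumes "X \<in> carrier_mat n m"
  shows "\<exists>U d. spectral_rep n (X * mat_adjoint X) U d"
  by (rule gram_spectral[OF assms]) blast

text \<open>Phrased with traces, so that no choice of diagonalisation enters and any convenient one
  may be used later.\<close>

definition mat_ent :: "real \<Rightarrow> real \<Rightarrow> complex mat \<Rightarrow> real" where
  "mat_ent \<alpha> s X = (let \<rho> = X * mat_adjoint X; p = Re (mat_trace \<rho>)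
     in \<alpha> / (1 - \<alpha>) * (p * dpow (s * \<alpha>) (Re (mat_trace (mat_powr \<rho> \<alpha>)) powr (1 / \<alpha>) / p)))"

lemma mat_ent_spectral:
  assumes "spectral_rep n (X * mat_adjoint X) U d"
  shows "mat_ent \<alpha> s X = gen_entropy \<alpha> s {..<n} d"
  unfolding mat_ent_def gen_entropy_def Let_def lp_norm_def
    trace_mat_powr_spectral[OF assms] trace_spectral[OF assms] ..

section \<open>Monotonicity under one round\<close>

lemma measurement_entries:
  assumes "measurement d Ks" "i < d" "k < d"
  shows "(\<Sum>j<length Ks. (mat_adjoint (Ks ! j) * (Ks ! j)) $$ (i, k)) = (if i = k then 1 else 0)"
proof -
  let ?F = "\<lambda>Ks. foldr (\<lambda>K S. mat_adjoint K * K + S) Ks (0\<^sub>m d d)"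
  \<comment> \<open>Completeness is not inherited by the tail of a list, so the induction computes
    the entries of the sum from the column dimensions alone.\<close>
  have "?F Ks \<in> carrier_mat d d \<and> ?F Ks $$ (i, k) = (\<Sum>K\<leftarrow>Ks. (mat_adjoint K * K) $$ (i, k))"
    if "\<forall>K\<in>set Ks. dim_col K = d" for Ks :: "complex mat list"
    using that
  proof (induction Ks)
    case (Cons K Ks)
    have K: "mat_adjoint K * K \<in> carrier_mat d d"
      using Cons.prems by (intro mult_carrier_mat[of _ d "dim_row K"]) auto
    have F: "?F Ks \<in> carrier_mat d d" using Cons by simp
    show ?case
      using Cons K F index_add_mat(1)[of i "?F Ks" k "mat_adjoint K * K"] assms(2,3)
      by (simp del: index_mult_mat(1) index_add_mat(1))
  qed (use assms(2,3) in auto)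
  from this[of Ks] assms show ?thesis
    unfolding measurement_def by (auto simp: sum_list_sum_nth atLeast0LessThan simp del: index_mult_mat(1))
qed

text \<open>Bessel's inequality for the vectors \<open>\<surd>(d i / \<lambda> k) * S i k\<close>, which are orthonormal in \<open>k\<close>.\<close>

lemma bessel_weights:
  fixes S :: "nat \<Rightarrow> nat \<Rightarrow> complex" and d l :: "nat \<Rightarrow> real"
  assumes d: "\<And>i. i < n \<Longrightarrow> d i \<ge> 0" and l: "\<And>k. k < m \<Longrightarrow> l k \<ge> 0"
    and orth: "\<And>k k'. k < m \<Longrightarrow> k' < m \<Longrightarrow>
      (\<Sum>i<n. cnj (S i k) * complex_of_real (d i) * S i k') = (if k = k' then complex_of_real (l k) else 0)"
    and i: "i < n"
  shows "(\<Sum>k<m. d i * (cmod (S i k))\<^sup>2 / l k) \<le> 1"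
proof -
  \<comment> \<open>Where \<open>l k\<close> is 0, division by zero makes the whole vector zero; the
    family is orthonormal on the remaining indices, as \<open>qq\<close> records.\<close>
  define q where "q a k = complex_of_real (sqrt (d a) / sqrt (l k)) * S a k" for a k
  define t where "t = (\<Sum>k<m. (cmod (q i k))\<^sup>2)"
  \<comment> \<open>This is the orthogonal projection of the i-th unit vector onto the span of the
    q-vectors. Its squared norm and its i-th coordinate are both t, whence t^2 \<le> t.\<close>
  define h where "h a = (\<Sum>k<m. cnj (q i k) * q a k)" for a
  have qq: "(\<Sum>a<n. cnj (q a k) * q a k') = (if k = k' \<and> l k \<noteq> 0 then 1 else 0)"
    if k: "k < m" "k' < m" for k k'
  proof -
    have "(\<Sum>a<n. cnj (q a k) * q a k')
        = (\<Sum>a<n. complex_of_real (1 / (sqrt (l k) * sqrt (l k'))) * (cnj (S a k) * complex_of_real (d a) * S a k'))"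
    proof (intro sum.cong refl)
      fix a assume "a \<in> {..<n}"
      then have "complex_of_real (d a) = complex_of_real (sqrt (d a)) * complex_of_real (sqrt (d a))"
        using d unfolding of_real_mult[symmetric] by simp
      then show "cnj (q a k) * q a k'
        = complex_of_real (1 / (sqrt (l k) * sqrt (l k'))) * (cnj (S a k) * complex_of_real (d a) * S a k')"
        by (simp add: q_def)
    qed
    also have "\<dots> = complex_of_real (1 / (sqrt (l k) * sqrt (l k'))) * (if k = k' then complex_of_real (l k) else 0)"
      unfolding sum_distrib_left[symmetric] orth[OF k] ..
    also have "\<dots> = (if k = k' \<and> l k \<noteq> 0 then 1 else 0)"
      using l[OF k(1)] by (auto simp flip: of_real_mult)
    finally show ?thesis .
  qed
  have "complex_of_real (\<Sum>a<n. (cmod (h a))\<^sup>2) = (\<Sum>a<n. \<Sum>k<m. \<Sum>k'<m. cnj (q i k) * q a k * (q i k' * cnj (q a k')))"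
    unfolding of_real_sum complex_norm_square h_def by (simp add: sum_product)
  also have "\<dots> = (\<Sum>k<m. \<Sum>k'<m. \<Sum>a<n. cnj (q i k) * q a k * (q i k' * cnj (q a k')))"
    by (subst sum.swap) (intro sum.cong refl sum.swap)
  also have "\<dots> = (\<Sum>k<m. \<Sum>k'<m. cnj (q i k) * q i k' * (\<Sum>a<n. cnj (q a k') * q a k))"
    by (simp add: sum_distrib_left mult_ac)
  also have "\<dots> = (\<Sum>k<m. \<Sum>k'<m. if k' = k then cnj (q i k) * q i k else 0)"
    by (intro sum.cong refl) (auto simp: qq, auto simp: q_def)
  also have "\<dots> = complex_of_real t"
    unfolding t_def of_real_sum complex_norm_square by (simp add: mult.commute)
  finally have norm_h: "(\<Sum>a<n. (cmod (h a))\<^sup>2) = t" unfolding of_real_eq_iff .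
  have "h i = complex_of_real t"
    unfolding t_def of_real_sum complex_norm_square h_def by (simp add: mult.commute)
  then have "t\<^sup>2 = (cmod (h i))\<^sup>2" by simp
  also have "\<dots> \<le> (\<Sum>a<n. (cmod (h a))\<^sup>2)" using i by (intro member_le_sum) auto
  finally have "t * t \<le> t * 1" unfolding norm_h by (simp add: power2_eq_square)
  then have "t \<le> 1"
    using mult_le_cancel_left_pos[of t t 1] sum_nonneg[of "{..<m}" "\<lambda>k. (cmod (q i k))\<^sup>2"]
    unfolding t_def[symmetric] by fastforce
  moreover have "t = (\<Sum>k<m. d i * (cmod (S i k))\<^sup>2 / l k)"
    unfolding t_def using d[OF i] l
    by (intro sum.cong refl) (simp add: q_def norm_mult power_mult_distrib power_divide norm_divide)
  ultimately show ?thesis by simp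
qed

text \<open>K^T times the conjugate of K is the transpose of K^* K, so completeness makes the Gram
  matrices of the outcomes add up to X X^*. An eigenvalue of X X^* is then a diagonal entry, in the
  basis U, of a sum of matrices with eigenbases V j; the change of basis W j has rows and columns of
  norm one.\<close>

lemma mat_ent_round_A:
  assumes \<alpha>: "\<alpha> > 0" "\<alpha> < 1 \<and> s * \<alpha> \<le> 1 \<or> \<alpha> > 1 \<and> s * \<alpha> \<ge> 1"
    and Ks: "measurement dA Ks" and X: "X \<in> carrier_mat dB dA"
  shows "(\<Sum>j<length Ks. mat_ent \<alpha> s (X * transpose_mat (Ks ! j))) \<le> mat_ent \<alpha> s X"
proof -
  define m where "m j = dim_row (Ks ! j)" for j
  define Y where "Y j = X * transpose_mat (Ks ! j)" for j
  have Kc: "Ks ! j \<in> carrier_mat (m j) dA" if "j < length Ks" for j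
    using Ks that by (intro carrier_matI) (auto simp: measurement_def m_def)
  have Yc: "Y j \<in> carrier_mat dB (m j)" if "j < length Ks" for j
    unfolding Y_def using Kc[OF that] X by (intro mult_carrier_mat[of X dB dA]) auto
  obtain U d where Ud: "spectral_rep dB (X * mat_adjoint X) U d" using gram_spectral_exists[OF X] by blast
  have "\<exists>V l. spectral_rep dB (Y j * mat_adjoint (Y j)) V l" if "j < length Ks" for j
    by (rule gram_spectral_exists[OF Yc[OF that]])
  then obtain V l where Vl: "\<And>j. j < length Ks \<Longrightarrow> spectral_rep dB (Y j * mat_adjoint (Y j)) (V j) (l j)"
    by metis
  have uU: "is_unitary dB U" using Ud by (simp add: spectral_rep_def)
  have uV: "is_unitary dB (V j)" if "j < length Ks" for j using Vl[OF that] by (simp add: spectral_rep_def)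
  note U = is_unitaryD[OF uU] and V = is_unitaryD[OF uV]
  have Gc: "X * mat_adjoint X \<in> carrier_mat dB dB" using X by (intro mult_carrier_mat) auto
  have YGc: "Y j * mat_adjoint (Y j) \<in> carrier_mat dB dB" if "j < length Ks" for j
    using Yc[OF that] by (intro mult_carrier_mat) auto
  define W where "W j = mat_adjoint U * V j" for j
  have uW: "is_unitary dB (W j)" if "j < length Ks" for j
    unfolding W_def using uU uV[OF that] by (intro is_unitary_mult is_unitary_adjoint)
  note Wc = is_unitaryD(1)[OF uW]
  have gram: "(X * mat_adjoint X) $$ (a, b) = (\<Sum>j<length Ks. (Y j * mat_adjoint (Y j)) $$ (a, b))"
    if ab: "a < dB" "b < dB" for a b
  proof -
    \<comment> \<open>Isolating the factor K^* K, with its indices exchanged by the transposition,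
      prepares for the completeness relation.\<close>
    have "(Y j * mat_adjoint (Y j)) $$ (a, b)
      = (\<Sum>c<dA. \<Sum>c'<dA. X $$ (a, c) * cnj (X $$ (b, c')) * (mat_adjoint (Ks ! j) * (Ks ! j)) $$ (c', c))"
      if j: "j < length Ks" for j
    proof -
      let ?K = "Ks ! j"
      have "Y j $$ (a, r) = (\<Sum>c<dA. X $$ (a, c) * ?K $$ (r, c))" if "a < dB" "r < m j" for a r
        unfolding Y_def using that X Kc[OF j] by (subst index_mult_sum) auto
      then have "(Y j * mat_adjoint (Y j)) $$ (a, b)
        = (\<Sum>r<m j. \<Sum>c<dA. \<Sum>c'<dA. X $$ (a, c) * ?K $$ (r, c) * cnj (X $$ (b, c') * ?K $$ (r, c')))"
        using ab by (simp add: index_gram[OF Yc[OF j]] sum_product)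
      also have "\<dots> = (\<Sum>c<dA. \<Sum>c'<dA. \<Sum>r<m j. X $$ (a, c) * ?K $$ (r, c) * cnj (X $$ (b, c') * ?K $$ (r, c')))"
        by (subst sum.swap) (intro sum.cong refl sum.swap)
      also have "\<dots> = (\<Sum>c<dA. \<Sum>c'<dA. X $$ (a, c) * cnj (X $$ (b, c')) * (mat_adjoint ?K * ?K) $$ (c', c))"
        using Kc[OF j] by (intro sum.cong refl, subst index_mult_sum)
          (auto simp: sum_distrib_left mult_ac intro!: sum.cong)
      finally show ?thesis .
    qed
    then have "(\<Sum>j<length Ks. (Y j * mat_adjoint (Y j)) $$ (a, b))
      = (\<Sum>j<length Ks. \<Sum>c<dA. \<Sum>c'<dA. X $$ (a, c) * cnj (X $$ (b, c')) * (mat_adjoint (Ks ! j) * (Ks ! j)) $$ (c', c))"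
      by simp
    also have "\<dots> = (\<Sum>c<dA. \<Sum>c'<dA. \<Sum>j<length Ks. X $$ (a, c) * cnj (X $$ (b, c')) * (mat_adjoint (Ks ! j) * (Ks ! j)) $$ (c', c))"
      by (subst sum.swap) (intro sum.cong refl sum.swap)
    also have "\<dots> = (\<Sum>c<dA. \<Sum>c'<dA. if c' = c then X $$ (a, c) * cnj (X $$ (b, c)) else 0)"
      unfolding sum_distrib_left[symmetric]
      by (intro sum.cong refl) (simp add: measurement_entries[OF Ks] del: index_mult_mat(1))
    also have "\<dots> = (X * mat_adjoint X) $$ (a, b)" by (simp add: index_gram[OF X ab])
    finally show ?thesis ..
  qed
  have d: "d i = (\<Sum>j<length Ks. \<Sum>k<dB. (cmod (W j $$ (i, k)))\<^sup>2 * l j k)" if i: "i < dB" for i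
  proof -
    have "complex_of_real (d i) = (mat_adjoint U * (X * mat_adjoint X) * U) $$ (i, i)"
      unfolding spectral_rep_diag[OF Ud] using i by (simp add: mat_diag_def)
    also have "\<dots> = (\<Sum>a<dB. \<Sum>b<dB. \<Sum>j<length Ks. cnj (U $$ (a, i)) * (Y j * mat_adjoint (Y j)) $$ (a, b) * U $$ (b, i))"
      unfolding index_conjugation[OF Gc U(1) i i]
      by (intro sum.cong refl) (simp add: gram sum_distrib_left sum_distrib_right del: index_mult_mat(1))
    also have "\<dots> = (\<Sum>j<length Ks. \<Sum>a<dB. \<Sum>b<dB. cnj (U $$ (a, i)) * (Y j * mat_adjoint (Y j)) $$ (a, b) * U $$ (b, i))"
      by (subst sum.swap[of _ "{..<length Ks}"], subst sum.swap[of _ _ "{..<length Ks}"]) (rule refl)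
    also have "\<dots> = (\<Sum>j<length Ks. (mat_adjoint U * (Y j * mat_adjoint (Y j)) * U) $$ (i, i))"
      using index_conjugation[OF YGc U(1) i i] by simp
    also have "\<dots> = (\<Sum>j<length Ks. \<Sum>k<dB. W j $$ (i, k) * complex_of_real (l j k) * cnj (W j $$ (i, k)))"
    proof (intro sum.cong refl)
      fix j assume "j \<in> {..<length Ks}"
      then have j: "j < length Ks" by simp
      let ?L = "mat_diag dB (\<lambda>k. complex_of_real (l j k))"
      have adjW: "mat_adjoint (W j) = mat_adjoint (V j) * U"
        unfolding W_def
        using mat_adjoint_mult[OF mat_adjoint_carrier[OF U(1)] V(1)[OF j]] by simp
      have "W j * ?L * mat_adjoint (W j) = mat_adjoint (mat_adjoint (W j)) * ?L * mat_adjoint (W j)"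
        by simp
      also have "\<dots> = mat_adjoint U * (V j * ?L * mat_adjoint (V j)) * U"
        unfolding adjW
        using mat_conjugation_mult[OF mat_diag_dim mat_adjoint_carrier[OF V(1)[OF j]] U(1)] by simp
      also have "V j * ?L * mat_adjoint (V j) = Y j * mat_adjoint (Y j)"
        using Vl[OF j] unfolding spectral_rep_def by metis
      finally have "mat_adjoint U * (Y j * mat_adjoint (Y j)) * U = W j * ?L * mat_adjoint (W j)" ..
      then show "(mat_adjoint U * (Y j * mat_adjoint (Y j)) * U) $$ (i, i) =
        (\<Sum>k<dB. W j $$ (i, k) * complex_of_real (l j k) * cnj (W j $$ (i, k)))"
        using index_conjugated_diag[OF Wc[OF j] i i] by simp
    qed
    also have "\<dots> = complex_of_real (\<Sum>j<length Ks. \<Sum>k<dB. (cmod (W j $$ (i, k)))\<^sup>2 * l j k)"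
      unfolding of_real_sum of_real_mult complex_norm_square by (simp add: mult_ac)
    finally show ?thesis unfolding of_real_eq_iff .
  qed
  have "(\<Sum>j<length Ks. gen_entropy \<alpha> s {..<dB} (l j)) \<le> gen_entropy \<alpha> s {..<dB} d"
    by (rule gen_entropy_superadditive[where P = "\<lambda>i j k. (cmod (W j $$ (i, k)))\<^sup>2", OF _ _ _ \<alpha>])
      (use Vl d unitary_row_norm[OF uW] unitary_column_norm[OF uW] in \<open>auto simp: spectral_rep_def\<close>)
  then show ?thesis
    using mat_ent_spectral[OF Vl] mat_ent_spectral[OF Ud] by (simp add: Y_def)
qed

text \<open>Two identities for the matrices \<open>S j\<close> carry the proof. \<open>SDS\<close>
  says that S^* D S is the diagonal matrix of outcome eigenvalues; it supplies the orthogonality for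
  Bessel and the column sums. \<open>SS\<close> is completeness seen in the eigenbasis of X X^*:
  over all outcomes together, each row has norm one, which recovers \<open>d i\<close>.\<close>

lemma mat_ent_round_B:
  assumes \<alpha>: "\<alpha> > 0" "\<alpha> < 1 \<and> s * \<alpha> \<le> 1 \<or> \<alpha> > 1 \<and> s * \<alpha> \<ge> 1"
    and Ks: "measurement dB Ks" and X: "X \<in> carrier_mat dB dA"
  shows "(\<Sum>j<length Ks. mat_ent \<alpha> s (Ks ! j * X)) \<le> mat_ent \<alpha> s X"
proof -
  define m where "m j = dim_row (Ks ! j)" for j
  have Kc: "Ks ! j \<in> carrier_mat (m j) dB" if "j < length Ks" for j
    using Ks that by (intro carrier_matI) (auto simp: measurement_def m_def)
  define Y where "Y j = Ks ! j * X" for j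
  have Yc: "Y j \<in> carrier_mat (m j) dA" if "j < length Ks" for j
    unfolding Y_def using Kc[OF that] X by (intro mult_carrier_mat) auto
  let ?G = "X * mat_adjoint X"
  obtain U d where Ud: "spectral_rep dB ?G U d" using gram_spectral_exists[OF X] by blast
  have "\<exists>V l. spectral_rep (m j) (Y j * mat_adjoint (Y j)) V l" if "j < length Ks" for j
    by (rule gram_spectral_exists[OF Yc[OF that]])
  then obtain V l where Vl: "\<And>j. j < length Ks \<Longrightarrow> spectral_rep (m j) (Y j * mat_adjoint (Y j)) (V j) (l j)"
    by metis
  have uU: "is_unitary dB U" using Ud by (simp add: spectral_rep_def)
  have uV: "is_unitary (m j) (V j)" if "j < length Ks" for j using Vl[OF that] by (simp add: spectral_rep_def)
  note U = is_unitaryD[OF uU] and V = is_unitaryD[OF uV]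
  have Gc: "?G \<in> carrier_mat dB dB" using X by (intro mult_carrier_mat) auto
  have d0: "d i \<ge> 0" if "i < dB" for i using Ud that by (simp add: spectral_rep_def)
  have l0: "l j k \<ge> 0" if "j < length Ks" "k < m j" for j k using Vl[OF that(1)] that by (simp add: spectral_rep_def)
  let ?D = "mat_diag dB (\<lambda>i. complex_of_real (d i))"
  \<comment> \<open>The adjoint of the Kraus operator, written in the eigenbases of X X^* and of the
    j-th outcome operator.\<close>
  define S where "S j = mat_adjoint U * (mat_adjoint (Ks ! j) * V j)" for j
  have KVc: "mat_adjoint (Ks ! j) * V j \<in> carrier_mat dB (m j)" if "j < length Ks" for j
    using Kc[OF that] V(1)[OF that] by (intro mult_carrier_mat) auto
  have Sc: "S j \<in> carrier_mat dB (m j)" if "j < length Ks" for j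
    unfolding S_def by (rule mult_carrier_mat[OF mat_adjoint_carrier[OF U(1)] KVc[OF that]])
  have SDS: "(\<Sum>i<dB. cnj (S j $$ (i, k)) * complex_of_real (d i) * S j $$ (i, k')) =
      (if k = k' then complex_of_real (l j k) else 0)" if j: "j < length Ks" and k: "k < m j" "k' < m j" for j k k'
  proof -
    let ?K = "Ks ! j"
    have "mat_adjoint (S j) * ?D * S j = mat_adjoint (mat_adjoint ?K * V j) * ?G * (mat_adjoint ?K * V j)"
      unfolding S_def using mat_conjugation_mult[OF mat_diag_dim mat_adjoint_carrier[OF U(1)] KVc[OF j]] Ud
      by (simp add: spectral_rep_def)
    also have "\<dots> = mat_adjoint (V j) * (?K * ?G * mat_adjoint ?K) * V j"
      using mat_conjugation_mult[OF Gc mat_adjoint_carrier[OF Kc[OF j]] V(1)[OF j]] by simp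
    also have "?K * ?G * mat_adjoint ?K = Y j * mat_adjoint (Y j)"
    proof -
      have "Y j * mat_adjoint (Y j) = ?K * X * (mat_adjoint X * mat_adjoint ?K)"
        unfolding Y_def by (simp add: mat_adjoint_mult[OF Kc[OF j] X])
      also have "\<dots> = ?K * X * mat_adjoint X * mat_adjoint ?K"
        using Kc[OF j] X by (intro assoc_mult_mat[symmetric]) auto
      also have "?K * X * mat_adjoint X = ?K * ?G"
        using Kc[OF j] X by (intro assoc_mult_mat) auto
      finally show ?thesis ..
    qed
    also have "mat_adjoint (V j) * (Y j * mat_adjoint (Y j)) * V j = mat_diag (m j) (\<lambda>k. complex_of_real (l j k))"
      by (rule spectral_rep_diag[OF Vl[OF j]])
    finally have SDS: "mat_adjoint (S j) * ?D * S j = mat_diag (m j) (\<lambda>k. complex_of_real (l j k))" .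
    have "(mat_adjoint (S j) * ?D * S j) $$ (k, k')
      = (\<Sum>i<dB. \<Sum>b<dB. cnj (S j $$ (i, k)) * ?D $$ (i, b) * S j $$ (b, k'))"
      by (rule index_conjugation[OF mat_diag_dim Sc[OF j] k])
    also have "\<dots> = (\<Sum>i<dB. \<Sum>b<dB. if b = i then cnj (S j $$ (i, k)) * complex_of_real (d i) * S j $$ (i, k') else 0)"
      by (intro sum.cong refl) (auto simp: mat_diag_def)
    finally show ?thesis unfolding SDS using k by (auto simp: mat_diag_def)
  qed
  have SS: "(\<Sum>j<length Ks. \<Sum>k<m j. (cmod (S j $$ (i, k)))\<^sup>2) = 1" if i: "i < dB" for i
  proof -
    have "complex_of_real (\<Sum>j<length Ks. \<Sum>k<m j. (cmod (S j $$ (i, k)))\<^sup>2)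
      = (\<Sum>j<length Ks. (mat_adjoint U * (mat_adjoint (Ks ! j) * (Ks ! j)) * U) $$ (i, i))"
      unfolding of_real_sum
    proof (intro sum.cong refl)
      fix j assume "j \<in> {..<length Ks}"
      then have j: "j < length Ks" by simp
      let ?K = "Ks ! j" let ?T = "mat_adjoint ?K * V j"
      have TT: "?T * mat_adjoint ?T = mat_adjoint ?K * ?K"
      proof -
        have "?T * mat_adjoint ?T = mat_adjoint ?K * V j * (mat_adjoint (V j) * ?K)"
          using Kc[OF j] V(1)[OF j] by (simp add: mat_adjoint_mult[of "mat_adjoint ?K" dB "m j" "V j" "m j"])
        also have "\<dots> = mat_adjoint ?K * (V j * (mat_adjoint (V j) * ?K))"
          using Kc[OF j] V(1)[OF j] by (intro assoc_mult_mat[of _ dB "m j" _ "m j" _ dB] mult_carrier_mat) auto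
        also have "V j * (mat_adjoint (V j) * ?K) = V j * mat_adjoint (V j) * ?K"
          using Kc[OF j] V(1)[OF j] by (intro assoc_mult_mat[symmetric]) auto
        finally show ?thesis using V[OF j] Kc[OF j] left_mult_one_mat[OF Kc[OF j]] by simp
      qed
      have adjS: "mat_adjoint (S j) = mat_adjoint ?T * U"
        unfolding S_def using KVc[OF j] U(1) by (simp add: mat_adjoint_mult[of "mat_adjoint U" dB dB ?T "m j"])
      \<comment> \<open>Inserting an identity in the middle lets the conjugation lemma regroup the
        product.\<close>
      have "S j * mat_adjoint (S j)
        = mat_adjoint (mat_adjoint ?T * U) * 1\<^sub>m (m j) * (mat_adjoint ?T * U)"
        unfolding adjS[symmetric] using right_mult_one_mat[OF Sc[OF j]] by simp
      also have "\<dots> = mat_adjoint U * (?T * 1\<^sub>m (m j) * mat_adjoint ?T) * U"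
        using mat_conjugation_mult[OF one_carrier_mat mat_adjoint_carrier[OF KVc[OF j]] U(1)] by simp
      also have "?T * 1\<^sub>m (m j) * mat_adjoint ?T = mat_adjoint ?K * ?K"
        using right_mult_one_mat[OF KVc[OF j]] TT by simp
      finally have "S j * mat_adjoint (S j) = mat_adjoint U * (mat_adjoint ?K * ?K) * U" .
      then show "(\<Sum>k<m j. complex_of_real ((cmod (S j $$ (i, k)))\<^sup>2))
        = (mat_adjoint U * (mat_adjoint ?K * ?K) * U) $$ (i, i)"
        using index_gram[OF Sc[OF j] i i] unfolding complex_norm_square by simp
    qed
    also have "\<dots> = (\<Sum>j<length Ks. \<Sum>a<dB. \<Sum>b<dB. cnj (U $$ (a, i)) * (mat_adjoint (Ks ! j) * (Ks ! j)) $$ (a, b) * U $$ (b, i))"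
    proof (intro sum.cong refl)
      fix j assume "j \<in> {..<length Ks}"
      then have "mat_adjoint (Ks ! j) * (Ks ! j) \<in> carrier_mat dB dB"
        using Kc[of j] by (intro mult_carrier_mat) auto
      then show "(mat_adjoint U * (mat_adjoint (Ks ! j) * (Ks ! j)) * U) $$ (i, i) =
        (\<Sum>a<dB. \<Sum>b<dB. cnj (U $$ (a, i)) * (mat_adjoint (Ks ! j) * (Ks ! j)) $$ (a, b) * U $$ (b, i))"
        by (rule index_conjugation[OF _ U(1) i i])
    qed
    also have "\<dots> = (\<Sum>a<dB. \<Sum>b<dB. \<Sum>j<length Ks. cnj (U $$ (a, i)) * (mat_adjoint (Ks ! j) * (Ks ! j)) $$ (a, b) * U $$ (b, i))"
      by (subst sum.swap) (intro sum.cong refl sum.swap)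
    also have "\<dots> = (\<Sum>a<dB. \<Sum>b<dB. if b = a then cnj (U $$ (a, i)) * U $$ (a, i) else 0)"
      unfolding sum_distrib_left[symmetric] sum_distrib_right[symmetric]
      by (intro sum.cong refl) (simp add: measurement_entries[OF Ks] del: index_mult_mat(1))
    also have "\<dots> = complex_of_real (\<Sum>a<dB. (cmod (U $$ (a, i)))\<^sup>2)"
      unfolding of_real_sum complex_norm_square by (simp add: mult.commute)
    finally show ?thesis unfolding of_real_eq_iff using unitary_column_norm[OF uU i] by simp
  qed
  have l_eq: "(\<Sum>i<dB. d i * (cmod (S j $$ (i, k)))\<^sup>2) = l j k" if j: "j < length Ks" "k < m j" for j k
  proof -
    have "complex_of_real (\<Sum>i<dB. d i * (cmod (S j $$ (i, k)))\<^sup>2) = complex_of_real (l j k)"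
      using SDS[OF j(1,2,2)] unfolding of_real_sum of_real_mult complex_norm_square by (simp add: mult_ac)
    then show ?thesis unfolding of_real_eq_iff .
  qed
  \<comment> \<open>The share of the outcome eigenvalue \<open>l j k\<close> that stems from the
    i-th eigenvector of X X^*.\<close>
  define P where "P i j k = d i * (cmod (S j $$ (i, k)))\<^sup>2 / l j k" for i j k
  have "(\<Sum>j<length Ks. gen_entropy \<alpha> s {..<m j} (l j)) \<le> gen_entropy \<alpha> s {..<dB} d"
  proof (rule gen_entropy_superadditive[where P = P, OF _ _ _ \<alpha>])
    fix i j assume "i \<in> {..<dB}" "j \<in> {..<length Ks}"
    then show "(\<Sum>k<m j. P i j k) \<le> 1"
      unfolding P_def by (intro bessel_weights[where n = dB and S = "\<lambda>i k. S j $$ (i, k)"] SDS d0 l0) auto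
  next
    fix j k assume "j \<in> {..<length Ks}" "k \<in> {..<m j}" "l j k > 0"
    then show "(\<Sum>i<dB. P i j k) = 1"
      unfolding P_def using l_eq[of j k] by (simp add: sum_divide_distrib[symmetric])
  next
    fix i assume i: "i \<in> {..<dB}"
    \<comment> \<open>If \<open>l j k\<close> is 0, then P is 0 by division by zero; the right side
      vanishes too, being one of the nonnegative terms that sum to \<open>l j k\<close>.\<close>
    have "P i j k * l j k = d i * (cmod (S j $$ (i, k)))\<^sup>2" if j: "j < length Ks" "k < m j" for j k
    proof (cases "l j k = 0")
      case True
      then have "d i * (cmod (S j $$ (i, k)))\<^sup>2 = 0"
        using l_eq[OF j] i d0 sum_nonneg_eq_0_iff[of "{..<dB}" "\<lambda>i. d i * (cmod (S j $$ (i, k)))\<^sup>2"] by auto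
      with True show ?thesis by simp
    qed (simp add: P_def)
    then have "(\<Sum>j<length Ks. \<Sum>k<m j. P i j k * l j k)
      = d i * (\<Sum>j<length Ks. \<Sum>k<m j. (cmod (S j $$ (i, k)))\<^sup>2)"
      by (simp add: sum_distrib_left)
    then show "d i = (\<Sum>j<length Ks. \<Sum>k<m j. P i j k * l j k)" using SS i by simp
  qed (use d0 l0 in \<open>auto simp: P_def\<close>)
  then show ?thesis
    using mat_ent_spectral[OF Vl] mat_ent_spectral[OF Ud] by (simp add: Y_def)
qed

section \<open>Protocols and coefficient matrices\<close>

text \<open>Regroups a sum over the flat list of outcomes by the outcome of the first round.\<close>

lemma sum_list_concat_map2:
  fixes f :: "'c \<Rightarrow> 'd :: comm_monoid_add"
  assumes "length Ks = length Ls"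
  shows "(\<Sum>x\<leftarrow>concat (map2 (\<lambda>K L. map (g K) L) Ks Ls). f x)
    = (\<Sum>j<length Ks. \<Sum>x\<leftarrow>Ls ! j. f (g (Ks ! j) x))"
  using assms
  by (induction Ks Ls rule: list_induct2) (simp_all add: o_def sum.lessThan_Suc_shift del: sum.lessThan_Suc)

text \<open>The bound is claimed for every X because the continuation after outcome j starts from
  another, unnormalised state, \<open>X * transpose_mat (Ks ! j)\<close> or
  \<open>Ks ! j * X\<close>. The induction hypothesis bounds each continuation by the entropy of its
  start, and one round bounds the sum of these. The dimensions are carried along since reassociating
  the products depends on them.\<close>

lemma slocc_protocol_mono:
  assumes \<alpha>: "\<alpha> > 0" "\<alpha> < 1 \<and> s * \<alpha> \<le> 1 \<or> \<alpha> > 1 \<and> s * \<alpha> \<ge> 1"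
  shows "slocc_protocol dA dB L \<Longrightarrow>
    (\<forall>(A, B)\<in>set L. dim_col A = dA \<and> dim_col B = dB) \<and>
    (\<forall>X\<in>carrier_mat dB dA. (\<Sum>(A, B)\<leftarrow>L. mat_ent \<alpha> s (B * X * transpose_mat A)) \<le> mat_ent \<alpha> s X)"
proof (induction rule: slocc_protocol.induct)
  case (stop dA dB)
  show ?case by (auto simp: left_mult_one_mat right_mult_one_mat)
next
  case (round_A dA Ks Ls dB)
  have Kdim: "dim_col (Ks ! j) = dA" if "j < length Ks" for j
    using round_A.hyps(1) that by (auto simp: measurement_def)
  have IH: "dim_col A = dim_row (Ks ! j)" "dim_col B = dB" if "j < length Ks" "(A, B) \<in> set (Ls ! j)" for j A B
    using round_A.IH that by fastforce+
  let ?L = "concat (map2 (\<lambda>K L. map (\<lambda>(A, B). (A * K, B)) L) Ks Ls)"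
  have "\<forall>(A, B)\<in>set ?L. dim_col A = dA \<and> dim_col B = dB"
    using round_A.hyps(2) Kdim IH by (fastforce simp: set_zip)
  moreover have "(\<Sum>(A, B)\<leftarrow>?L. mat_ent \<alpha> s (B * X * transpose_mat A)) \<le> mat_ent \<alpha> s X"
    if X: "X \<in> carrier_mat dB dA" for X
  proof -
    have "(\<Sum>(A, B)\<leftarrow>?L. mat_ent \<alpha> s (B * X * transpose_mat A))
      = (\<Sum>j<length Ks. \<Sum>m\<leftarrow>Ls ! j. case (case m of (A, B) \<Rightarrow> (A * (Ks ! j), B)) of (A, B) \<Rightarrow> mat_ent \<alpha> s (B * X * transpose_mat A))"
      using round_A.hyps(2) by (intro sum_list_concat_map2) simp
    also have "\<dots> = (\<Sum>j<length Ks. \<Sum>(A, B)\<leftarrow>Ls ! j. mat_ent \<alpha> s (B * (X * transpose_mat (Ks ! j)) * transpose_mat A))"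
    proof (intro sum.cong refl arg_cong[of _ _ sum_list] map_cong)
      fix j m assume jm: "j \<in> {..<length Ks}" "m \<in> set (Ls ! j)"
      obtain A B where m: "m = (A, B)" by fastforce
      with jm have dims: "dim_col A = dim_row (Ks ! j)" "dim_col B = dB" "dim_col (Ks ! j) = dA"
        using IH[of j A B] Kdim[of j] by auto
      let ?K = "Ks ! j"
      have "B * X * transpose_mat (A * ?K) = B * X * (transpose_mat ?K * transpose_mat A)"
        using dims by (subst transpose_mult[of A "dim_row A" "dim_row ?K" ?K dA]) auto
      also have "\<dots> = B * X * transpose_mat ?K * transpose_mat A"
        using dims X by (intro assoc_mult_mat[symmetric, of _ "dim_row B" dA _ "dim_row ?K" _ "dim_row A"] mult_carrier_mat[of _ _ dB]) auto
      also have "B * X * transpose_mat ?K = B * (X * transpose_mat ?K)"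
        using dims X by (intro assoc_mult_mat[of _ "dim_row B" dB _ dA _ "dim_row ?K"]) auto
      finally show "(case (case m of (A, B) \<Rightarrow> (A * ?K, B)) of (A, B) \<Rightarrow> mat_ent \<alpha> s (B * X * transpose_mat A))
        = (case m of (A, B) \<Rightarrow> mat_ent \<alpha> s (B * (X * transpose_mat ?K) * transpose_mat A))"
        by (simp add: m)
    qed
    also have "\<dots> \<le> (\<Sum>j<length Ks. mat_ent \<alpha> s (X * transpose_mat (Ks ! j)))"
    proof (intro sum_mono)
      fix j assume "j \<in> {..<length Ks}"
      then have j: "j < length Ks" by simp
      have "X * transpose_mat (Ks ! j) \<in> carrier_mat dB (dim_row (Ks ! j))"
        using X Kdim[OF j] by (intro mult_carrier_mat[of X dB dA]) auto
      then show "(\<Sum>(A, B)\<leftarrow>Ls ! j. mat_ent \<alpha> s (B * (X * transpose_mat (Ks ! j)) * transpose_mat A)) \<le> mat_ent \<alpha> s (X * transpose_mat (Ks ! j))"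
        using round_A.IH j by blast
    qed
    also have "\<dots> \<le> mat_ent \<alpha> s X" by (rule mat_ent_round_A[OF \<alpha> round_A.hyps(1) X])
    finally show ?thesis .
  qed
  ultimately show ?case by blast
next
  case (round_B dB Ks Ls dA)
  have Kdim: "dim_col (Ks ! j) = dB" if "j < length Ks" for j
    using round_B.hyps(1) that by (auto simp: measurement_def)
  have IH: "dim_col A = dA" "dim_col B = dim_row (Ks ! j)" if "j < length Ks" "(A, B) \<in> set (Ls ! j)" for j A B
    using round_B.IH that by fastforce+
  let ?L = "concat (map2 (\<lambda>K L. map (\<lambda>(A, B). (A, B * K)) L) Ks Ls)"
  have "\<forall>(A, B)\<in>set ?L. dim_col A = dA \<and> dim_col B = dB"
    using round_B.hyps(2) Kdim IH by (fastforce simp: set_zip)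
  moreover have "(\<Sum>(A, B)\<leftarrow>?L. mat_ent \<alpha> s (B * X * transpose_mat A)) \<le> mat_ent \<alpha> s X"
    if X: "X \<in> carrier_mat dB dA" for X
  proof -
    have "(\<Sum>(A, B)\<leftarrow>?L. mat_ent \<alpha> s (B * X * transpose_mat A))
      = (\<Sum>j<length Ks. \<Sum>m\<leftarrow>Ls ! j. case (case m of (A, B) \<Rightarrow> (A, B * (Ks ! j))) of (A, B) \<Rightarrow> mat_ent \<alpha> s (B * X * transpose_mat A))"
      using round_B.hyps(2) by (intro sum_list_concat_map2) simp
    also have "\<dots> = (\<Sum>j<length Ks. \<Sum>(A, B)\<leftarrow>Ls ! j. mat_ent \<alpha> s (B * (Ks ! j * X) * transpose_mat A))"
    proof (intro sum.cong refl arg_cong[of _ _ sum_list] map_cong)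
      fix j m assume jm: "j \<in> {..<length Ks}" "m \<in> set (Ls ! j)"
      obtain A B where m: "m = (A, B)" by fastforce
      with jm have dims: "dim_col A = dA" "dim_col B = dim_row (Ks ! j)" "dim_col (Ks ! j) = dB"
        using IH[of j A B] Kdim[of j] by auto
      let ?K = "Ks ! j"
      have "B * ?K * X = B * (?K * X)"
        using dims X by (intro assoc_mult_mat[of _ "dim_row B" "dim_row ?K" _ dB _ dA]) auto
      then show "(case (case m of (A, B) \<Rightarrow> (A, B * ?K)) of (A, B) \<Rightarrow> mat_ent \<alpha> s (B * X * transpose_mat A))
        = (case m of (A, B) \<Rightarrow> mat_ent \<alpha> s (B * (?K * X) * transpose_mat A))"
        by (simp add: m)
    qed
    also have "\<dots> \<le> (\<Sum>j<length Ks. mat_ent \<alpha> s (Ks ! j * X))"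
    proof (intro sum_mono)
      fix j assume "j \<in> {..<length Ks}"
      then have j: "j < length Ks" by simp
      have "Ks ! j * X \<in> carrier_mat (dim_row (Ks ! j)) dA"
        using X Kdim[OF j] by (intro mult_carrier_mat[of _ _ dB]) auto
      then show "(\<Sum>(A, B)\<leftarrow>Ls ! j. mat_ent \<alpha> s (B * (Ks ! j * X) * transpose_mat A)) \<le> mat_ent \<alpha> s (Ks ! j * X)"
        using round_B.IH j by blast
    qed
    also have "\<dots> \<le> mat_ent \<alpha> s X" by (rule mat_ent_round_B[OF \<alpha> round_B.hyps(1) X])
    finally show ?thesis .
  qed
  ultimately show ?case by blast
qed

section \<open>Bipartite vectors as coefficient matrices\<close>

definition coeff_mat :: "nat \<Rightarrow> nat \<Rightarrow> complex vec \<Rightarrow> complex mat" where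
  "coeff_mat dA dB \<Psi> = mat dB dA (\<lambda>(k, i). \<Psi> $ (i * dB + k))"

lemma coeff_mat_carrier [simp, intro]: "coeff_mat dA dB \<Psi> \<in> carrier_mat dB dA"
  by (simp add: coeff_mat_def)

lemma coeff_mat_dim [simp]:
  "dim_row (coeff_mat dA dB \<Psi>) = dB" "dim_col (coeff_mat dA dB \<Psi>) = dA"
  by (simp_all add: coeff_mat_def)

lemma sum_product_index:
  fixes f :: "nat \<Rightarrow> 'a :: comm_monoid_add"
  shows "(\<Sum>c<a * b. f c) = (\<Sum>i<a. \<Sum>k<b. f (i * b + k))"
proof -
  have "(\<Sum>c<a * b. f c) = (\<Sum>i<a. sum f {i * b..<i * b + b})"
    by (rule sum.nat_group[symmetric])
  also have "\<dots> = (\<Sum>i<a. \<Sum>k<b. f (i * b + k))"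
  proof (rule sum.cong[OF refl])
    fix i
    show "sum f {i * b..<i * b + b} = (\<Sum>k<b. f (i * b + k))"
      using sum.shift_bounds_nat_ivl[of f 0 "i * b" b] by (simp add: atLeast0LessThan add.commute)
  qed
  finally show ?thesis .
qed

lemma product_index_less: "i < a \<Longrightarrow> k < b \<Longrightarrow> i * b + k < a * (b :: nat)"
  using mult_le_mono1[of "Suc i" a b] by simp

lemma reduced_B_gram:
  assumes "\<Psi> \<in> carrier_vec (dA * dB)"
  shows "reduced_B dA dB \<Psi> = coeff_mat dA dB \<Psi> * mat_adjoint (coeff_mat dA dB \<Psi>)"
proof (intro eq_matI)
  let ?X = "coeff_mat dA dB \<Psi>"
  fix k l assume "k < dim_row (?X * mat_adjoint ?X)" "l < dim_col (?X * mat_adjoint ?X)"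
  then have kl: "k < dB" "l < dB" by auto
  show "reduced_B dA dB \<Psi> $$ (k, l) = (?X * mat_adjoint ?X) $$ (k, l)"
    unfolding index_gram[OF coeff_mat_carrier kl] using kl assms
    by (simp add: reduced_B_def ptrace_A_def projector_def coeff_mat_def product_index_less)
qed (auto simp: reduced_B_def ptrace_A_def)

lemma norm_sq_trace:
  assumes "\<Psi> \<in> carrier_vec (dA * dB)"
  shows "norm_sq \<Psi> = Re (mat_trace (coeff_mat dA dB \<Psi> * mat_adjoint (coeff_mat dA dB \<Psi>)))"
proof -
  let ?X = "coeff_mat dA dB \<Psi>"
  have "\<Psi> \<bullet>c \<Psi> = (\<Sum>c<dA * dB. \<Psi> $ c * cnj (\<Psi> $ c))"
    using assms by (simp add: scalar_prod_def atLeast0LessThan)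
  also have "\<dots> = (\<Sum>k<dB. \<Sum>i<dA. \<Psi> $ (i * dB + k) * cnj (\<Psi> $ (i * dB + k)))"
    unfolding sum_product_index by (rule sum.swap)
  also have "\<dots> = mat_trace (?X * mat_adjoint ?X)"
    by (simp add: mat_trace_def index_gram[OF coeff_mat_carrier] del: index_mult_mat(1), simp add: coeff_mat_def)
  finally show ?thesis by (simp add: norm_sq_def)
qed

text \<open>The vec identity for Kronecker products; a transpose rather than an adjoint appears
  because the A index of X carries no conjugation.\<close>

lemma coeff_mat_tensor:
  assumes "\<Psi> \<in> carrier_vec (dA * dB)" "A \<in> carrier_mat mA dA" "B \<in> carrier_mat mB dB"
  shows "coeff_mat mA mB (tensor_mat A B *\<^sub>v \<Psi>) = B * coeff_mat dA dB \<Psi> * transpose_mat A"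
proof (intro eq_matI)
  let ?X = "coeff_mat dA dB \<Psi>"
  fix t r assume "t < dim_row (B * ?X * transpose_mat A)" "r < dim_col (B * ?X * transpose_mat A)"
  then have tr: "t < mB" "r < mA" using assms by auto
  have BX: "(B * ?X) $$ (t, i) = (\<Sum>k<dB. B $$ (t, k) * \<Psi> $ (i * dB + k))" if "i < dA" for i
    using that tr assms(3) by (subst index_mult_sum) (auto simp: coeff_mat_def)
  have "coeff_mat mA mB (tensor_mat A B *\<^sub>v \<Psi>) $$ (t, r)
    = (\<Sum>c<dA * dB. A $$ (r, c div dB) * B $$ (t, c mod dB) * \<Psi> $ c)"
    using tr assms product_index_less[OF tr(2,1)]
    by (simp add: coeff_mat_def tensor_mat_def scalar_prod_def atLeast0LessThan)
  also have "\<dots> = (\<Sum>i<dA. \<Sum>k<dB. A $$ (r, i) * B $$ (t, k) * \<Psi> $ (i * dB + k))"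
    unfolding sum_product_index by (intro sum.cong[OF refl]) auto
  also have "\<dots> = (\<Sum>i<dA. (B * ?X) $$ (t, i) * A $$ (r, i))"
    by (simp add: BX sum_distrib_left mult_ac del: index_mult_mat(1))
  also have "\<dots> = (B * ?X * transpose_mat A) $$ (t, r)"
    using tr assms by (subst index_mult_sum[of _ "transpose_mat A"]) auto
  finally show "coeff_mat mA mB (tensor_mat A B *\<^sub>v \<Psi>) $$ (t, r) = (B * ?X * transpose_mat A) $$ (t, r)" .
qed (use assms in auto)

lemma tensor_mat_mult_carrier:
  "A \<in> carrier_mat mA dA \<Longrightarrow> B \<in> carrier_mat mB dB \<Longrightarrow> tensor_mat A B *\<^sub>v \<Psi> \<in> carrier_vec (mA * mB)"
  by (intro carrier_vecI) (auto simp: tensor_mat_def)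

section \<open>Positivity of the trace, the limit in s, and agreement with the homogeneous
  entropy\<close>

lemma mat_powr_trace_pos:
  assumes "spectral_rep n A U d" "Re (mat_trace A) > 0"
  shows "Re (mat_trace (mat_powr A a)) > 0"
proof -
  have d: "d i \<ge> 0" if "i < n" for i using assms(1) that by (simp add: spectral_rep_def)
  obtain i where "i < n" "d i \<noteq> 0"
    using assms(2) unfolding trace_spectral[OF assms(1)] by (metis lessThan_iff less_irrefl sum.neutral)
  then have "(\<Sum>i<n. d i powr a) > 0"
    by (intro sum_pos2[of _ i]) auto
  then show ?thesis unfolding trace_mat_powr_spectral[OF assms(1)] .
qed

text \<open>The derivative of t \<mapsto> exp (t c x) at 0, divided by c.\<close>

lemma tendsto_expm1_divide:
  fixes c x :: real
  assumes "c \<noteq> 0"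
  shows "((\<lambda>t. 1 / (t * c) * (exp (t * c * x) - 1)) \<longlongrightarrow> x) (at 0)"
proof -
  have "((\<lambda>t. exp (t * c * x)) has_real_derivative c * x) (at 0)"
    by (auto intro!: derivative_eq_intros)
  then have "((\<lambda>t. (exp (t * c * x) - 1) / t) \<longlongrightarrow> c * x) (at 0)"
    by (simp add: has_field_derivative_iff)
  then have "((\<lambda>t. (exp (t * c * x) - 1) / t / c) \<longlongrightarrow> c * x / c) (at 0)"
    by (intro tendsto_divide tendsto_const assms)
  then show ?thesis using assms by (simp add: mult.commute)
qed

lemma gen_EE_zero:
  assumes "\<alpha> \<noteq> 1"
  shows "gen_EE dA dB \<alpha> 0 \<Psi> = renyi_EE dA dB \<alpha> \<Psi>"
proof -
  have "Lim (at 0) (\<lambda>t. 1 / (t * (1 - \<alpha>)) * (exp (t * (1 - \<alpha>) * renyi_EE dA dB \<alpha> \<Psi>) - 1))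
    = renyi_EE dA dB \<alpha> \<Psi>"
    using assms by (intro tendsto_Lim tendsto_expm1_divide) auto
  then show ?thesis unfolding gen_EE_def Let_def by simp
qed

lemma gen_EE_tendsto:
  assumes "\<alpha> \<noteq> 1"
  shows "((\<lambda>t. gen_EE dA dB \<alpha> t \<Psi>) \<longlongrightarrow> renyi_EE dA dB \<alpha> \<Psi>) (at 0)"
proof (rule Lim_transform_eventually)
  show "((\<lambda>t. 1 / (t * (1 - \<alpha>)) * (exp (t * (1 - \<alpha>) * renyi_EE dA dB \<alpha> \<Psi>) - 1))
      \<longlongrightarrow> renyi_EE dA dB \<alpha> \<Psi>) (at 0)"
    using assms by (intro tendsto_expm1_divide) simp
qed (auto simp: gen_EE_def eventually_at_filter)

lemma gen_EE_powr:
  assumes \<alpha>: "\<alpha> \<noteq> 1" and s: "s \<noteq> 0"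
    and T: "Re (mat_trace (mat_powr (reduced_B dA dB \<Psi>) \<alpha>)) > 0"
  shows "gen_EE dA dB \<alpha> s \<Psi> =
    1 / (s * (1 - \<alpha>)) * (Re (mat_trace (mat_powr (reduced_B dA dB \<Psi>) \<alpha>)) powr s - 1)"
  using assms by (simp add: gen_EE_def renyi_EE_def powr_def)

text \<open>For trace one the ratio N / p is T powr (1 / \<alpha>). Its power with exponent s
  \<alpha> is T powr s, and the prefactor \<alpha> cancels against the denominator s \<alpha>; at s
  = 0 it cancels against the exponent 1 / \<alpha> inside the logarithm.\<close>

lemma gen_EE_mat_ent:
  assumes "\<alpha> > 0" "\<alpha> \<noteq> 1" and \<Psi>: "bipartite_state dA dB \<Psi>"
  shows "gen_EE dA dB \<alpha> s \<Psi> = mat_ent \<alpha> s (coeff_mat dA dB \<Psi>)"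
proof -
  let ?X = "coeff_mat dA dB \<Psi>"
  have \<Psi>c: "\<Psi> \<in> carrier_vec (dA * dB)" and norm: "norm_sq \<Psi> = 1"
    using \<Psi> by (auto simp: bipartite_state_def)
  define T where "T = Re (mat_trace (mat_powr (?X * mat_adjoint ?X) \<alpha>))"
  have p: "Re (mat_trace (?X * mat_adjoint ?X)) = 1" using norm_sq_trace[OF \<Psi>c] norm by simp
  have T: "T > 0"
    unfolding T_def using gram_spectral_exists[of ?X dB dA] mat_powr_trace_pos p by fastforce
  have ent: "mat_ent \<alpha> s ?X = \<alpha> / (1 - \<alpha>) * dpow (s * \<alpha>) (T powr (1 / \<alpha>))"
    by (simp add: mat_ent_def p T_def)
  show ?thesis
  proof (cases "s = 0")
    case True
    then show ?thesis
      unfolding ent using assms T by (simp add: gen_EE_zero renyi_EE_def reduced_B_gram[OF \<Psi>c] T_def[symmetric] dpow_def ln_powr)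
  next
    case False
    then show ?thesis
      using assms T gen_EE_powr[of \<alpha> s dA dB \<Psi>]
      by (simp add: ent reduced_B_gram[OF \<Psi>c] T_def[symmetric] dpow_def powr_powr)
  qed
qed

section \<open>Homogeneity and normalised outcome states\<close>

lemma spectral_rep_smult:
  assumes "spectral_rep n A U d" "c \<ge> 0"
  shows "spectral_rep n (complex_of_real c \<cdot>\<^sub>m A) U (\<lambda>i. c * d i)"
proof -
  have u: "is_unitary n U" and A: "A = U * mat_diag n (\<lambda>i. complex_of_real (d i)) * mat_adjoint U"
    using assms by (auto simp: spectral_rep_def)
  note U = is_unitaryD[OF u]
  have Ac: "A \<in> carrier_mat n n" by (rule spectral_rep_carrier[OF assms(1)])
  have "complex_of_real c \<cdot>\<^sub>m A = U * mat_diag n (\<lambda>i. complex_of_real (c * d i)) * mat_adjoint U"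
  proof (intro eq_matI)
    fix i j assume "i < dim_row (U * mat_diag n (\<lambda>i. complex_of_real (c * d i)) * mat_adjoint U)"
      "j < dim_col (U * mat_diag n (\<lambda>i. complex_of_real (c * d i)) * mat_adjoint U)"
    then have ij: "i < n" "j < n" using U(1) by auto
    then have "(complex_of_real c \<cdot>\<^sub>m A) $$ (i, j) = complex_of_real c * A $$ (i, j)" using Ac by simp
    also have "\<dots> = (U * mat_diag n (\<lambda>i. complex_of_real (c * d i)) * mat_adjoint U) $$ (i, j)"
      unfolding A index_conjugated_diag[OF U(1) ij] by (simp add: sum_distrib_left mult_ac)
    finally show "(complex_of_real c \<cdot>\<^sub>m A) $$ (i, j)
      = (U * mat_diag n (\<lambda>i. complex_of_real (c * d i)) * mat_adjoint U) $$ (i, j)" .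
  qed (use Ac U(1) in auto)
  then show ?thesis using assms u by (auto simp: spectral_rep_def)
qed

lemma gen_entropy_scale:
  assumes "\<alpha> > 0" "c > 0" "\<And>i. i \<in> I \<Longrightarrow> d i \<ge> 0"
  shows "gen_entropy \<alpha> s I (\<lambda>i. c * d i) = c * gen_entropy \<alpha> s I d"
proof -
  have "(\<Sum>i\<in>I. (c * d i) powr \<alpha>) = c powr \<alpha> * (\<Sum>i\<in>I. d i powr \<alpha>)"
    using assms by (simp add: powr_mult sum_distrib_left)
  then have "lp_norm \<alpha> I (\<lambda>i. c * d i) = c * lp_norm \<alpha> I d"
    using assms by (simp add: lp_norm_def powr_mult sum_nonneg powr_powr)
  then show ?thesis using assms by (simp add: gen_entropy_def sum_distrib_left[symmetric])
qed

text \<open>The entropy has degree one in X X^*, which is quadratic in X.\<close>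

lemma mat_ent_scale:
  assumes "X \<in> carrier_mat n m" "\<alpha> > 0" "c > 0"
  shows "mat_ent \<alpha> s (complex_of_real c \<cdot>\<^sub>m X) = c\<^sup>2 * mat_ent \<alpha> s X"
proof -
  obtain U d where Ud: "spectral_rep n (X * mat_adjoint X) U d"
    using gram_spectral_exists[OF assms(1)] by blast
  have "(complex_of_real c \<cdot>\<^sub>m X) * mat_adjoint (complex_of_real c \<cdot>\<^sub>m X)
    = complex_of_real (c\<^sup>2) \<cdot>\<^sub>m (X * mat_adjoint X)"
  proof (intro eq_matI)
    fix i j assume "i < dim_row (complex_of_real (c\<^sup>2) \<cdot>\<^sub>m (X * mat_adjoint X))"
      "j < dim_col (complex_of_real (c\<^sup>2) \<cdot>\<^sub>m (X * mat_adjoint X))"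
    then have ij: "i < n" "j < n" using assms(1) by auto
    have cX: "complex_of_real c \<cdot>\<^sub>m X \<in> carrier_mat n m" using assms(1) by simp
    have "(complex_of_real (c\<^sup>2) \<cdot>\<^sub>m (X * mat_adjoint X)) $$ (i, j)
      = complex_of_real (c\<^sup>2) * (X * mat_adjoint X) $$ (i, j)" using ij assms(1) by simp
    also have "\<dots> = ((complex_of_real c \<cdot>\<^sub>m X) * mat_adjoint (complex_of_real c \<cdot>\<^sub>m X)) $$ (i, j)"
      unfolding index_gram[OF assms(1) ij] index_gram[OF cX ij]
      using ij assms(1) by (simp add: sum_distrib_left power2_eq_square mult_ac)
    finally show "((complex_of_real c \<cdot>\<^sub>m X) * mat_adjoint (complex_of_real c \<cdot>\<^sub>m X)) $$ (i, j)
      = (complex_of_real (c\<^sup>2) \<cdot>\<^sub>m (X * mat_adjoint X)) $$ (i, j)" ..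
  qed (use assms(1) in auto)
  then have "spectral_rep n ((complex_of_real c \<cdot>\<^sub>m X) * mat_adjoint (complex_of_real c \<cdot>\<^sub>m X)) U (\<lambda>i. c\<^sup>2 * d i)"
    using spectral_rep_smult[OF Ud, of "c\<^sup>2"] by simp
  from mat_ent_spectral[OF this] mat_ent_spectral[OF Ud] show ?thesis
    using gen_entropy_scale[of \<alpha> "c\<^sup>2" "{..<n}" d] assms Ud by (simp add: spectral_rep_def)
qed

text \<open>Normalising divides the vector by the square root of p, hence the homogeneous entropy by
  p, and the probability in front cancels this.\<close>

lemma outcome_gen_EE:
  assumes \<alpha>: "\<alpha> > 0" "\<alpha> \<noteq> 1" and \<Psi>: "\<Psi> \<in> carrier_vec (dA * dB)"
    and A: "A \<in> carrier_mat mA dA" and B: "B \<in> carrier_mat mB dB"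
    and p: "outcome_prob (A, B) \<Psi> > 0"
  shows "outcome_prob (A, B) \<Psi> * gen_EE mA mB \<alpha> s (outcome_state (A, B) \<Psi>)
    = mat_ent \<alpha> s (B * coeff_mat dA dB \<Psi> * transpose_mat A)"
proof -
  define \<Phi> where "\<Phi> = tensor_mat A B *\<^sub>v \<Psi>"
  define p where "p = norm_sq \<Phi>"
  have pp: "p > 0" "outcome_prob (A, B) \<Psi> = p"
    using p by (simp_all add: outcome_prob_def p_def \<Phi>_def)
  define c where "c = 1 / sqrt p"
  have c: "c > 0" "p * c\<^sup>2 = 1" using pp by (simp_all add: c_def power_divide)
  have \<Phi>: "\<Phi> \<in> carrier_vec (mA * mB)" unfolding \<Phi>_def by (rule tensor_mat_mult_carrier[OF A B])
  have state: "outcome_state (A, B) \<Psi> = complex_of_real c \<cdot>\<^sub>v \<Phi>"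
    by (simp add: outcome_state_def pp c_def \<Phi>_def)
  have coeff: "coeff_mat mA mB (outcome_state (A, B) \<Psi>) = complex_of_real c \<cdot>\<^sub>m coeff_mat mA mB \<Phi>"
    unfolding state using \<Phi> by (intro eq_matI) (auto simp: coeff_mat_def product_index_less)
  have "norm_sq (complex_of_real c \<cdot>\<^sub>v \<Phi>) = c\<^sup>2 * norm_sq \<Phi>"
    using \<Phi> by (simp add: norm_sq_def conjugate_smult_vec power2_eq_square)
  then have "bipartite_state mA mB (outcome_state (A, B) \<Psi>)"
    using \<Phi> c by (simp add: bipartite_state_def state p_def mult.commute)
  then have "p * gen_EE mA mB \<alpha> s (outcome_state (A, B) \<Psi>) = p * (c\<^sup>2 * mat_ent \<alpha> s (coeff_mat mA mB \<Phi>))"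
    using gen_EE_mat_ent[OF \<alpha>] mat_ent_scale[OF coeff_mat_carrier \<alpha>(1) c(1)] by (simp add: coeff)
  then show ?thesis
    using c coeff_mat_tensor[OF \<Psi> A B] by (simp add: pp \<Phi>_def mult.assoc[symmetric])
qed

text \<open>Discarded outcomes have trace zero, which annihilates the prefactor of the homogeneous
  entropy, so they may be put back into the sum.\<close>

lemma mat_ent_outcome_zero:
  assumes \<Psi>: "\<Psi> \<in> carrier_vec (dA * dB)" and A: "A \<in> carrier_mat mA dA" and B: "B \<in> carrier_mat mB dB"
    and p: "\<not> outcome_prob (A, B) \<Psi> > 0"
  shows "mat_ent \<alpha> s (B * coeff_mat dA dB \<Psi> * transpose_mat A) = 0"
proof -
  define Y where "Y = B * coeff_mat dA dB \<Psi> * transpose_mat A"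
  let ?\<Phi> = "tensor_mat A B *\<^sub>v \<Psi>"
  have Y: "Y = coeff_mat mA mB ?\<Phi>" unfolding Y_def by (rule coeff_mat_tensor[OF \<Psi> A B, symmetric])
  have "norm_sq ?\<Phi> = Re (mat_trace (Y * mat_adjoint Y))"
    unfolding Y by (rule norm_sq_trace[OF tensor_mat_mult_carrier[OF A B]])
  moreover have "norm_sq ?\<Phi> \<le> 0" using p by (simp add: outcome_prob_def)
  moreover have "Re (mat_trace (Y * mat_adjoint Y)) \<ge> 0"
  proof -
    have "Y \<in> carrier_mat mB mA" unfolding Y by simp
    then obtain U d where Ud: "spectral_rep mB (Y * mat_adjoint Y) U d"
      using gram_spectral_exists by blast
    then have "\<forall>i<mB. d i \<ge> 0" unfolding spectral_rep_def by blast
    then show ?thesis unfolding trace_spectral[OF Ud] by (intro sum_nonneg) simp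
  qed
  ultimately have "Re (mat_trace (Y * mat_adjoint Y)) = 0" by linarith
  then show ?thesis unfolding Y_def[symmetric] by (simp add: mat_ent_def)
qed

section \<open>Product vectors\<close>

lemma dpow_eq_0_iff: "x > 0 \<Longrightarrow> dpow \<beta> x = 0 \<longleftrightarrow> x = 1"
  by (cases "\<beta> = 0") (auto simp: dpow_def powr_def)

text \<open>On [0, 1] the term (1 - \<alpha>) (x powr \<alpha> - x) is nonnegative in both ranges of
  \<alpha> and vanishes only at the endpoints. Summed over the family it gives 1 - \<alpha> times
  the deviation of the power sum from 1, which is zero only if every term is.\<close>

lemma powr_sum_eq_1_iff:
  fixes d :: "'i \<Rightarrow> real"
  assumes "finite I" "\<And>i. i \<in> I \<Longrightarrow> d i \<ge> 0" "sum d I = 1" "\<alpha> > 0" "\<alpha> \<noteq> 1"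
  shows "(\<Sum>i\<in>I. d i powr \<alpha>) = 1 \<longleftrightarrow> (\<forall>i\<in>I. d i = 0 \<or> d i = 1)"
proof -
  have le1: "d i \<le> 1" if "i \<in> I" for i
    using that assms member_le_sum[of i I d] by auto
  define g where "g i = (1 - \<alpha>) * (d i powr \<alpha> - d i)" for i
  have g: "g i \<ge> 0" "g i = 0 \<longleftrightarrow> d i = 0 \<or> d i = 1" if i: "i \<in> I" for i
  proof -
    show "g i = 0 \<longleftrightarrow> d i = 0 \<or> d i = 1"
      using assms(2)[OF i] assms(5) powr_inj[of "d i" \<alpha> 1] by (cases "d i = 0 \<or> d i = 1") (auto simp: g_def)
    show "g i \<ge> 0"
    proof (cases "\<alpha> < 1")
      case True
      then have "d i powr \<alpha> \<ge> d i powr 1" using assms le1 i by (intro powr_mono') auto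
      with True assms(2)[OF i] show ?thesis by (simp add: g_def)
    next
      case False
      then have "d i powr \<alpha> \<le> d i powr 1" using assms le1 i by (intro powr_mono') auto
      with False assms(2)[OF i] show ?thesis by (simp add: g_def mult_nonpos_nonpos)
    qed
  qed
  have "(\<Sum>i\<in>I. d i powr \<alpha>) = 1 \<longleftrightarrow> sum g I = 0"
    using assms(3,5) by (simp add: g_def sum_distrib_left[symmetric] sum_subtractf)
  also have "\<dots> \<longleftrightarrow> (\<forall>i\<in>I. g i = 0)"
    using assms(1) g(1) by (intro sum_nonneg_eq_0_iff) auto
  finally show ?thesis using g(2) by simp
qed

text \<open>\<open>dpow\<close> has its only zero at 1, and the trace is 1, so the entropy vanishes
  exactly when N = 1, that is, when the power sum is 1.\<close>

lemma gen_EE_eq_0_iff: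
  assumes \<alpha>: "\<alpha> > 0" "\<alpha> \<noteq> 1" and \<Psi>: "bipartite_state dA dB \<Psi>"
    and Ud: "spectral_rep dB (coeff_mat dA dB \<Psi> * mat_adjoint (coeff_mat dA dB \<Psi>)) U d"
  shows "gen_EE dA dB \<alpha> s \<Psi> = 0 \<longleftrightarrow> (\<forall>i<dB. d i = 0 \<or> d i = 1)"
proof -
  have d: "d i \<ge> 0" if "i < dB" for i using Ud that by (simp add: spectral_rep_def)
  have sum_d: "(\<Sum>i<dB. d i) = 1"
    using \<Psi> norm_sq_trace[of \<Psi> dA dB] trace_spectral[OF Ud] by (simp add: bipartite_state_def)
  then have "\<exists>i<dB. d i \<noteq> 0" by (metis lessThan_iff sum.neutral zero_neq_one)
  then have "lp_norm \<alpha> {..<dB} d \<noteq> 0"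
    using \<alpha> d by (subst lp_norm_eq_0_iff) auto
  then have N: "lp_norm \<alpha> {..<dB} d > 0" using lp_norm_nonneg[of \<alpha> "{..<dB}" d] by linarith
  have "gen_EE dA dB \<alpha> s \<Psi> = 0 \<longleftrightarrow> lp_norm \<alpha> {..<dB} d = 1"
    using \<alpha> N by (simp add: gen_EE_mat_ent[OF \<alpha> \<Psi>] mat_ent_spectral[OF Ud] gen_entropy_def sum_d dpow_eq_0_iff)
  also have "\<dots> \<longleftrightarrow> (\<Sum>i<dB. d i powr \<alpha>) = 1"
    using \<alpha> N lp_norm_powr[of \<alpha> "{..<dB}" d] by (auto simp: lp_norm_def)
  also have "\<dots> \<longleftrightarrow> (\<forall>i<dB. d i = 0 \<or> d i = 1)"
    using powr_sum_eq_1_iff[of "{..<dB}" d \<alpha>] d sum_d \<alpha> by auto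
  finally show ?thesis .
qed

lemma separable_iff_coeff_mat:
  assumes "\<Psi> \<in> carrier_vec (dA * dB)"
  shows "separable_vec dA dB \<Psi> \<longleftrightarrow>
    (\<exists>a b. \<forall>i<dA. \<forall>k<dB. coeff_mat dA dB \<Psi> $$ (k, i) = a i * b k)"
proof
  assume "separable_vec dA dB \<Psi>"
  then obtain a b where "a \<in> carrier_vec dA" "b \<in> carrier_vec dB" "\<Psi> = tensor_vec a b"
    by (auto simp: separable_vec_def)
  then have "\<forall>i<dA. \<forall>k<dB. coeff_mat dA dB \<Psi> $$ (k, i) = a $ i * b $ k"
    using product_index_less by (auto simp: coeff_mat_def tensor_vec_def)
  then show "\<exists>a b. \<forall>i<dA. \<forall>k<dB. coeff_mat dA dB \<Psi> $$ (k, i) = a i * b k" by blast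
next
  assume "\<exists>a b. \<forall>i<dA. \<forall>k<dB. coeff_mat dA dB \<Psi> $$ (k, i) = a i * b k"
  then obtain a b where ab: "\<And>i k. i < dA \<Longrightarrow> k < dB \<Longrightarrow> coeff_mat dA dB \<Psi> $$ (k, i) = a i * b k" by blast
  have "\<Psi> = tensor_vec (vec dA a) (vec dB b)"
  proof (intro eq_vecI)
    fix c assume "c < dim_vec (tensor_vec (vec dA a) (vec dB b))"
    then have c: "c < dA * dB" by (simp add: tensor_vec_def)
    then have "dB > 0" by (cases dB) auto
    with c have ik: "c div dB < dA" "c mod dB < dB" by (auto simp: less_mult_imp_div_less)
    show "\<Psi> $ c = tensor_vec (vec dA a) (vec dB b) $ c"
      using ab[OF ik] ik c by (simp add: coeff_mat_def tensor_vec_def)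
  qed (use assms in \<open>simp add: tensor_vec_def\<close>)
  moreover have "vec dA a \<in> carrier_vec dA" "vec dB b \<in> carrier_vec dB" by simp_all
  ultimately show "separable_vec dA dB \<Psi>" unfolding separable_vec_def by blast
qed

text \<open>Product vectors are those with X of rank at most one, and the spectrum detects this
  through Y = U^* X, whose rows are orthogonal with squared norms \<open>d i\<close>. If X has rank
  one, the rows of Y are proportional, so at most one is nonzero. Conversely, if only row i0 of Y
  survives, then X = U Y is column i0 of U times that row.\<close>

lemma separable_iff_spectrum:
  assumes \<Psi>: "bipartite_state dA dB \<Psi>"
    and Ud: "spectral_rep dB (coeff_mat dA dB \<Psi> * mat_adjoint (coeff_mat dA dB \<Psi>)) U d"
    and d_eq: "\<And>i. i < dB \<Longrightarrow> d i = (\<Sum>a<dA. (cmod ((mat_adjoint U * coeff_mat dA dB \<Psi>) $$ (i, a)))\<^sup>2)"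
  shows "separable_vec dA dB \<Psi> \<longleftrightarrow> (\<forall>i<dB. d i = 0 \<or> d i = 1)"
proof -
  let ?X = "coeff_mat dA dB \<Psi>"
  define Y where "Y = mat_adjoint U * ?X"
  have \<Psi>c: "\<Psi> \<in> carrier_vec (dA * dB)" using \<Psi> by (simp add: bipartite_state_def)
  have uU: "is_unitary dB U" using Ud by (simp add: spectral_rep_def)
  note U = is_unitaryD[OF uU]
  have Yc: "Y \<in> carrier_mat dB dA" unfolding Y_def using U(1) by (intro mult_carrier_mat) auto
  have sum_d: "(\<Sum>i<dB. d i) = 1"
    using \<Psi> norm_sq_trace[of \<Psi> dA dB] trace_spectral[OF Ud] by (simp add: bipartite_state_def)
  have "U * Y = U * mat_adjoint U * ?X"
    unfolding Y_def
    by (rule assoc_mult_mat[OF U(1) mat_adjoint_carrier[OF U(1)] coeff_mat_carrier, symmetric])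
  also have "\<dots> = ?X" unfolding U(3) by (rule left_mult_one_mat[OF coeff_mat_carrier])
  finally have X_eq: "?X = U * Y" ..
  have d_Y: "d i = (\<Sum>a<dA. (cmod (Y $$ (i, a)))\<^sup>2)" if "i < dB" for i
    using d_eq[OF that] by (simp add: Y_def)
  show ?thesis
  proof
    assume "separable_vec dA dB \<Psi>"
    then obtain a b where ab: "\<And>i k. i < dA \<Longrightarrow> k < dB \<Longrightarrow> ?X $$ (k, i) = a i * b k"
      unfolding separable_iff_coeff_mat[OF \<Psi>c] by blast
    define c where "c i = (\<Sum>k<dB. cnj (U $$ (k, i)) * b k)" for i
    have Y_entry: "Y $$ (i, j) = c i * a j" if "i < dB" "j < dA" for i j
      unfolding Y_def c_def using that U(1) ab
      by (subst index_mult_sum) (auto simp: sum_distrib_right sum_distrib_left mult_ac intro!: sum.cong)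
    define n where "n = (\<Sum>j<dA. (cmod (a j))\<^sup>2)"
    have d_c: "d i = n * (cmod (c i))\<^sup>2" if "i < dB" for i
      using that by (simp add: d_Y Y_entry norm_mult power_mult_distrib n_def sum_distrib_left mult.commute)
    have YY: "Y * mat_adjoint Y = mat_diag dB (\<lambda>i. complex_of_real (d i))"
    proof -
      have "Y * mat_adjoint Y = mat_adjoint U * ?X * (mat_adjoint ?X * U)"
        unfolding Y_def using U(1) by (simp add: mat_adjoint_mult[OF mat_adjoint_carrier[OF U(1)] coeff_mat_carrier])
      also have "\<dots> = mat_adjoint U * ?X * mat_adjoint ?X * U"
        using assoc_mult_mat[OF Yc mat_adjoint_carrier[OF coeff_mat_carrier] U(1)] by (simp add: Y_def)
      also have "mat_adjoint U * ?X * mat_adjoint ?X = mat_adjoint U * (?X * mat_adjoint ?X)"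
        by (rule assoc_mult_mat[OF mat_adjoint_carrier[OF U(1)] coeff_mat_carrier
              mat_adjoint_carrier[OF coeff_mat_carrier]])
      finally show ?thesis using spectral_rep_diag[OF Ud] by simp
    qed
    \<comment> \<open>Up to the common factor n, the off-diagonal entry of Y Y^* is the product of c
      i and the conjugate of c j, and it vanishes because Y Y^* is diagonal.\<close>
    have orth: "d i * d j = 0" if ij: "i < dB" "j < dB" "i \<noteq> j" for i j
    proof -
      have "c i * cnj (c j) * complex_of_real n = (Y * mat_adjoint Y) $$ (i, j)"
        unfolding index_gram[OF Yc ij(1,2)] n_def of_real_sum complex_norm_square
        using ij by (simp add: Y_entry sum_distrib_left mult_ac)
      also have "\<dots> = 0" unfolding YY using ij by (simp add: mat_diag_def)
      finally show ?thesis using ij by (auto simp: d_c)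
    qed
    show "\<forall>i<dB. d i = 0 \<or> d i = 1"
    proof (intro allI impI)
      fix i assume i: "i < dB"
      \<comment> \<open>Multiplying the trace condition by \<open>d i\<close> leaves only the square
        of \<open>d i\<close>, so \<open>d i\<close> is idempotent.\<close>
      have "d i * 1 = (\<Sum>j<dB. d i * d j)" unfolding sum_d[symmetric] sum_distrib_left ..
      also have "\<dots> = (\<Sum>j<dB. if j = i then d i * d i else 0)"
        using orth i by (intro sum.cong refl) auto
      also have "\<dots> = d i * d i" using i by simp
      finally show "d i = 0 \<or> d i = 1" by auto
    qed
  next
    assume d01: "\<forall>i<dB. d i = 0 \<or> d i = 1"
    obtain i0 where i0: "i0 < dB" "d i0 = 1"
      using d01 sum_d by (metis lessThan_iff sum.neutral zero_neq_one)
    \<comment> \<open>A second eigenvalue 1 would make the trace at least 2.\<close>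
    have others: "d i = 0" if "i < dB" "i \<noteq> i0" for i
    proof (rule ccontr)
      assume "d i \<noteq> 0"
      then have "(\<Sum>j\<in>{i, i0}. d j) = 2" using d01 that i0 by auto
      moreover have "(\<Sum>j\<in>{i, i0}. d j) \<le> (\<Sum>j<dB. d j)"
        using that i0 Ud by (intro sum_mono2) (auto simp: spectral_rep_def)
      ultimately show False using sum_d by simp
    qed
    have Y0: "Y $$ (i, a) = 0" if "i < dB" "i \<noteq> i0" "a < dA" for i a
      using others[OF that(1,2)] d_Y[OF that(1)] that(3)
        sum_nonneg_eq_0_iff[of "{..<dA}" "\<lambda>a. (cmod (Y $$ (i, a)))\<^sup>2"] by auto
    have "?X $$ (k, j) = Y $$ (i0, j) * U $$ (k, i0)" if "j < dA" "k < dB" for j k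
    proof -
      have "?X $$ (k, j) = (\<Sum>i<dB. U $$ (k, i) * Y $$ (i, j))"
        using that U(1) Yc unfolding X_eq by (subst index_mult_sum) auto
      also have "\<dots> = (\<Sum>i<dB. if i = i0 then U $$ (k, i0) * Y $$ (i0, j) else 0)"
        using that Y0 by (intro sum.cong refl) auto
      finally show ?thesis using i0 by simp
    qed
    then show "separable_vec dA dB \<Psi>" unfolding separable_iff_coeff_mat[OF \<Psi>c]
      by (intro exI[of _ "\<lambda>j. Y $$ (i0, j)"] exI[of _ "\<lambda>k. U $$ (k, i0)"]) simp
  qed
qed

theorem proposition1:
  fixes \<alpha> s :: real and dA dB :: nat and \<Psi> :: "complex vec"
  assumes "\<alpha> > 0" and "\<alpha> \<noteq> 1" and "bipartite_state dA dB \<Psi>"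
  shows "((\<alpha>, s) \<in> Omega \<longrightarrow>
            (gen_EE dA dB \<alpha> s \<Psi> = 0 \<longleftrightarrow> separable_vec dA dB \<Psi>) \<and>
            (\<forall>L. slocc_protocol dA dB L \<longrightarrow>
               (\<Sum>(A, B) \<leftarrow> filter (\<lambda>m. outcome_prob m \<Psi> > 0) L.
                  outcome_prob (A, B) \<Psi> *
                  gen_EE (dim_row A) (dim_row B) \<alpha> s (outcome_state (A, B) \<Psi>))
               \<le> gen_EE dA dB \<alpha> s \<Psi>)) \<and>
         ((\<lambda>t. gen_EE dA dB \<alpha> t \<Psi>) \<longlongrightarrow> renyi_EE dA dB \<alpha> \<Psi>) (at 0) \<and>
         gen_EE dA dB \<alpha> 1 \<Psi> =
           1 / (1 - \<alpha>) * (Re (mat_trace (mat_powr (reduced_B dA dB \<Psi>) \<alpha>)) - 1)"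
proof -
  let ?X = "coeff_mat dA dB \<Psi>"
  have \<Psi>c: "\<Psi> \<in> carrier_vec (dA * dB)" and norm: "norm_sq \<Psi> = 1"
    using assms(3) by (auto simp: bipartite_state_def)
  obtain U d where Ud: "spectral_rep dB (?X * mat_adjoint ?X) U d"
    and d: "\<And>i. i < dB \<Longrightarrow> d i = (\<Sum>a<dA. (cmod ((mat_adjoint U * ?X) $$ (i, a)))\<^sup>2)"
    by (rule gram_spectral[OF coeff_mat_carrier[of dA dB \<Psi>]]) blast
  have zero: "gen_EE dA dB \<alpha> s \<Psi> = 0 \<longleftrightarrow> separable_vec dA dB \<Psi>"
    using gen_EE_eq_0_iff[OF assms Ud] separable_iff_spectrum[OF assms(3) Ud d] by simp
  have mono: "(\<Sum>(A, B) \<leftarrow> filter (\<lambda>m. outcome_prob m \<Psi> > 0) L.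
        outcome_prob (A, B) \<Psi> * gen_EE (dim_row A) (dim_row B) \<alpha> s (outcome_state (A, B) \<Psi>))
      \<le> gen_EE dA dB \<alpha> s \<Psi>"
    if \<Omega>: "(\<alpha>, s) \<in> Omega" and L: "slocc_protocol dA dB L" for L
  proof -
    \<comment> \<open>Multiplying by \<alpha> > 0 turns membership in \<Omega> into the concavity or
      convexity condition on the exponent s \<alpha>.\<close>
    have s: "\<alpha> < 1 \<and> s * \<alpha> \<le> 1 \<or> \<alpha> > 1 \<and> s * \<alpha> \<ge> 1"
      using \<Omega> assms(1) by (auto simp: Omega_def field_simps)
    note protocol = slocc_protocol_mono[OF assms(1) s L]
    \<comment> \<open>The filter becomes a conditional with value 0, which is also the homogeneous
      entropy of a discarded outcome; both sums then run over the same list and agree term by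
      term.\<close>
    have "(\<Sum>(A, B) \<leftarrow> filter (\<lambda>m. outcome_prob m \<Psi> > 0) L.
        outcome_prob (A, B) \<Psi> * gen_EE (dim_row A) (dim_row B) \<alpha> s (outcome_state (A, B) \<Psi>))
      = (\<Sum>(A, B)\<leftarrow>L. mat_ent \<alpha> s (B * ?X * transpose_mat A))"
      unfolding sum_list_map_filter'
    proof (intro arg_cong[of _ _ sum_list] map_cong refl)
      fix m assume m: "m \<in> set L"
      obtain A B where AB: "m = (A, B)" by fastforce
      then have c: "A \<in> carrier_mat (dim_row A) dA" "B \<in> carrier_mat (dim_row B) dB"
        using protocol m by auto
      show "(if outcome_prob m \<Psi> > 0 then case m of (A, B) \<Rightarrow>
          outcome_prob (A, B) \<Psi> * gen_EE (dim_row A) (dim_row B) \<alpha> s (outcome_state (A, B) \<Psi>) else 0)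
        = (case m of (A, B) \<Rightarrow> mat_ent \<alpha> s (B * ?X * transpose_mat A))"
        using outcome_gen_EE[OF assms(1,2) \<Psi>c c, of s] mat_ent_outcome_zero[OF \<Psi>c c, of \<alpha> s]
        by (simp add: AB)
    qed
    also have "\<dots> \<le> mat_ent \<alpha> s ?X" using protocol coeff_mat_carrier by blast
    finally show ?thesis by (simp add: gen_EE_mat_ent[OF assms])
  qed
  have "Re (mat_trace (?X * mat_adjoint ?X)) > 0" using norm norm_sq_trace[OF \<Psi>c] by simp
  then have "Re (mat_trace (mat_powr (reduced_B dA dB \<Psi>) \<alpha>)) > 0"
    unfolding reduced_B_gram[OF \<Psi>c] by (rule mat_powr_trace_pos[OF Ud])
  then have "gen_EE dA dB \<alpha> 1 \<Psi> = 1 / (1 - \<alpha>) * (Re (mat_trace (mat_powr (reduced_B dA dB \<Psi>) \<alpha>)) - 1)"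
    using gen_EE_powr[OF assms(2), of 1] by simp
  with zero mono gen_EE_tendsto[OF assms(2)] show ?thesis by blast
qed

end
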